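(* Let $M$ be a closed oriented triangulated $3$-manifold, with $N_0$ vertices and $N_1$ edges, in which every tetrahedron has four distinct vertices, and let generic coordinates $(x_A,y_A,z_A)\in\mathbb R^3$ be assigned to its vertices. Consider the sequence of linear maps $$0\longrightarrow \mathfrak e(3)\xrightarrow{f_1}(dx)\xrightarrow{f_2}(dl)\xrightarrow{f_3}(d\omega)\xrightarrow{f_4}(dx^* )\xrightarrow{f_5}\mathfrak e(3)^*\longrightarrow 0,$$ with $f_4=-f_2^{\mathrm T}$ and $f_5=f_1^{\mathrm T}$. Then this sequence is an algebraic complex: the composition of any two successive maps is zero.
   Context: Triangulations need not be combinatorial: a simplex may appear several times in the boundary of a higher simplex, and several simplices may share the same vertices; only the four vertices of each tetrahedron are required to be distinct. The coordinates are in general position with respect to all algebraic constructions below; in particular no oriented volume vanishes. The length of edge $AB$ is $l_{AB}=\sqrt{(x_B-x_A)^2+(y_B-y_A)^2+(z_B-z_A)^2}$. Each tetrahedron is written $ABCD$ with its vertices in an order giving its positive orientation (induced by the orientation of $M$), and its oriented volume is $V_{ABCD}=\frac16\det(\overrightarrow{AB},\overrightarrow{AC},\overrightarrow{AD})$, which may be of either sign. The inner dihedral angles of the Euclidean tetrahedron are taken with the sign of its volume, and are regarded as functions of the six edge lengths. For an edge $i$, the deficit angle is $\omega_i=-\sum_k\varphi_i^{(k)} \bmod 2\pi$, where the sum runs over the tetrahedra around $i$ and $\varphi_i^{(k)}$ is the signed dihedral angle of the $k$-th tetrahedron at $i$; here all edge lengths are allowed to vary independently (when lengths come from coordinates, $\omega_i\equiv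 0$). The spaces are spaces of column vectors: $\mathfrak e(3)$ is the $6$-dimensional Lie algebra of infinitesimal motions of $\mathbb R^3$ (basis: three translations and three rotations); $(dx)$ and $(dx^* )$ have dimension $3N_0$ with coordinates indexed by $(dx_A,dy_A,dz_A)$ over vertices $A$; $(dl)$ and $(d\omega)$ have dimension $N_1$ indexed by edges. The map $f_1$ sends an infinitesimal motion to the induced infinitesimal displacements of the vertex points $(x_A,y_A,z_A)$; $f_2$ is the Jacobian matrix of the edge lengths with respect to vertex coordinates; $f_3=(\partial\omega_i/\partial l_j)$, evaluated at the lengths coming from the coordinates. (The matrix $f_3$ is known to be symmetric.) *)

theory Defs
  imports "HOL-Analysis.Analysis"
begin

section \<open>Closed oriented triangulated 3-manifolds (possibly non-combinatorial)\<close>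

text \<open>
A triangulation is presented by gluing finitely many oriented tetrahedra (type 't)
along their faces.  Local vertex indices of a tetrahedron are 0,1,2,3, listed in the
order giving its positive orientation.  Face f of tetrahedron t is the face opposite
the local vertex f.  It is glued to the face  gperm t f f  of tetrahedron  glue t f,
the local vertex i of t being identified with the local vertex  gperm t f i.
vtx t i is the vertex (of type 'v) at local vertex i, edg t i j the edge (of type 'e)
joining local vertices i and j.
\<close>

definition loc :: "nat set" where "loc = {..<4}"

definition vrel :: "('t \<Rightarrow> nat \<Rightarrow> 't) \<Rightarrow> ('t \<Rightarrow> nat \<Rightarrow> nat \<Rightarrow> nat) \<Rightarrow> (('t \<times> nat) \<times> ('t \<times> nat)) set" where
  "vrel glue gperm = {((t, i), (glue t f, gperm t f i)) | t f i. f \<in> loc \<and> i \<in> loc \<and> i \<noteq> f}"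

definition erel :: "('t \<Rightarrow> nat \<Rightarrow> 't) \<Rightarrow> ('t \<Rightarrow> nat \<Rightarrow> nat \<Rightarrow> nat) \<Rightarrow> (('t \<times> nat \<times> nat) \<times> ('t \<times> nat \<times> nat)) set" where
  "erel glue gperm = {((t, i, j), (glue t f, gperm t f i, gperm t f j)) | t f i j.
      f \<in> loc \<and> i \<in> loc \<and> j \<in> loc \<and> i \<noteq> f \<and> j \<noteq> f \<and> i \<noteq> j}"

definition closed_oriented_triangulated_3manifold ::
  "('t::finite \<Rightarrow> nat \<Rightarrow> 't) \<Rightarrow> ('t \<Rightarrow> nat \<Rightarrow> nat \<Rightarrow> nat)
   \<Rightarrow> ('t \<Rightarrow> nat \<Rightarrow> 'v::finite) \<Rightarrow> ('t \<Rightarrow> nat \<Rightarrow> nat \<Rightarrow> 'e::finite) \<Rightarrow> bool" where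
  "closed_oriented_triangulated_3manifold glue gperm vtx edg \<longleftrightarrow>
     \<comment> \<open>face pairings: every face glued to exactly one other face (closedness)\<close>
     (\<forall>t. \<forall>f\<in>loc.
        bij_betw (gperm t f) loc loc
      \<and> (\<forall>i. i \<notin> loc \<longrightarrow> gperm t f i = i)
      \<and> (glue (glue t f) (gperm t f f) = t)
      \<and> (\<forall>i\<in>loc. gperm (glue t f) (gperm t f f) (gperm t f i) = i)
      \<and> (glue t f, gperm t f f) \<noteq> (t, f)
      \<comment> \<open>orientation: gluings are orientation reversing w.r.t. the positive orderings\<close>
      \<and> \<not> evenperm (gperm t f))
   \<comment> \<open>vertices are exactly the classes of corners under the face identifications\<close>
   \<and> (\<forall>t. \<forall>f\<in>loc. \<forall>i\<in>loc. i \<noteq> f \<longrightarrow> vtx (glue t f) (gperm t f i) = vtx t i)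
   \<and> (\<forall>t t' i j. i \<in> loc \<longrightarrow> j \<in> loc \<longrightarrow> vtx t i = vtx t' j \<longrightarrow>
        ((t, i), (t', j)) \<in> (vrel glue gperm)\<^sup>*)
   \<and> (\<forall>v. \<exists>t. \<exists>i\<in>loc. vtx t i = v)
   \<comment> \<open>edges are exactly the classes of tetrahedron edges under the face identifications\<close>
   \<and> (\<forall>t i j. edg t i j = edg t j i)
   \<and> (\<forall>t. \<forall>f\<in>loc. \<forall>i\<in>loc. \<forall>j\<in>loc. i \<noteq> f \<and> j \<noteq> f \<and> i \<noteq> j \<longrightarrow>
        edg (glue t f) (gperm t f i) (gperm t f j) = edg t i j)
   \<and> (\<forall>t t' i j k m. i \<in> loc \<longrightarrow> j \<in> loc \<longrightarrow> k \<in> loc \<longrightarrow> m \<in> loc \<longrightarrow> i \<noteq> j \<longrightarrow> k \<noteq> m \<longrightarrow>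
        edg t i j = edg t' k m \<longrightarrow>
        ((t, i, j), (t', k, m)) \<in> (erel glue gperm)\<^sup>* \<or> ((t, i, j), (t', m, k)) \<in> (erel glue gperm)\<^sup>*)
   \<and> (\<forall>e. \<exists>t. \<exists>i\<in>loc. \<exists>j\<in>loc. i \<noteq> j \<and> edg t i j = e)
   \<comment> \<open>every tetrahedron has four distinct vertices\<close>
   \<and> (\<forall>t. inj_on (vtx t) loc)
   \<comment> \<open>manifold condition: every vertex link (a closed connected orientable surface)
       is a 2-sphere, i.e. has Euler characteristic 2:
       #link vertices - #link edges + #link triangles = E_v - 3F_v/2 + F_v = 2\<close>
   \<and> (\<forall>v. 2 * int (card {e. \<exists>t. \<exists>i\<in>loc. \<exists>j\<in>loc. i \<noteq> j \<and> edg t i j = e \<and> vtx t i = v})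
          - int (card {t. \<exists>i\<in>loc. vtx t i = v}) = 4)"

section \<open>Geometry\<close>

text \<open>Oriented volume of the tetrahedron ABCD.\<close>
definition ovol :: "real^3 \<Rightarrow> real^3 \<Rightarrow> real^3 \<Rightarrow> real^3 \<Rightarrow> real" where
  "ovol A B C D = det (vector [B - A, C - A, D - A] :: real^3^3) / 6"

text \<open>Unsigned inner dihedral angle at edge AB of the Euclidean tetrahedron ABCD, i.e. the
angle between the components of AC and AD orthogonal to the line AB.\<close>
definition perp_to :: "real^3 \<Rightarrow> real^3 \<Rightarrow> real^3" where
  "perp_to u w = w - ((w \<bullet> u) / (u \<bullet> u)) *\<^sub>R u"

definition dihedral_pts :: "real^3 \<Rightarrow> real^3 \<Rightarrow> real^3 \<Rightarrow> real^3 \<Rightarrow> real" where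
  "dihedral_pts A B C D =
     (let p = perp_to (B - A) (C - A); q = perp_to (B - A) (D - A)
      in arccos ((p \<bullet> q) / (norm p * norm q)))"

text \<open>The two local vertices of a tetrahedron other than i and j.\<close>
definition other1 :: "nat \<Rightarrow> nat \<Rightarrow> nat" where
  "other1 i j = (LEAST k. k \<in> loc \<and> k \<noteq> i \<and> k \<noteq> j)"
definition other2 :: "nat \<Rightarrow> nat \<Rightarrow> nat" where
  "other2 i j = (GREATEST k. k \<in> loc \<and> k \<noteq> i \<and> k \<noteq> j)"

text \<open>Dihedral angle at local edge ij as a function of the six edge lengths
 (ell a b = length of the edge joining local vertices a and b): it is the dihedral angle of
 a Euclidean tetrahedron realizing these lengths (independent of the realization).\<close>
definition realizes :: "(nat \<Rightarrow> nat \<Rightarrow> real) \<Rightarrow> (nat \<Rightarrow> real^3) \<Rightarrow> bool" where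
  "realizes ell P \<longleftrightarrow> (\<forall>a\<in>loc. \<forall>b\<in>loc. a \<noteq> b \<longrightarrow> dist (P a) (P b) = ell a b)"

definition dihedral_len :: "(nat \<Rightarrow> nat \<Rightarrow> real) \<Rightarrow> nat \<Rightarrow> nat \<Rightarrow> real" where
  "dihedral_len ell i j =
     (let P = (SOME P. realizes ell P)
      in dihedral_pts (P i) (P j) (P (other1 i j)) (P (other2 i j)))"

section \<open>The maps of the complex\<close>

context
  fixes vtx :: "'t::finite \<Rightarrow> nat \<Rightarrow> 'v::finite"
    and edg :: "'t \<Rightarrow> nat \<Rightarrow> nat \<Rightarrow> 'e::finite"
begin

definition tvol :: "real^3^'v \<Rightarrow> 't \<Rightarrow> real" where
  "tvol X t = ovol (X $ vtx t 0) (X $ vtx t 1) (X $ vtx t 2) (X $ vtx t 3)"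

text \<open>Edge lengths as functions of the vertex coordinates.\<close>
definition edge_lengths :: "real^3^'v \<Rightarrow> real^'e" where
  "edge_lengths X = (\<chi> e. (let (t, i, j) = (SOME (t, i, j). i \<in> loc \<and> j \<in> loc \<and> i \<noteq> j \<and> edg t i j = e)
                          in dist (X $ vtx t i) (X $ vtx t j)))"

text \<open>Minus the sum of the signed dihedral angles around each edge, as a function of
 independently varying edge lengths; the signs are those of the volumes of the tetrahedra in
 the coordinate configuration X0.  The deficit angle is this quantity mod 2 pi, which has the
 same derivative.\<close>
definition neg_angle_sum :: "real^3^'v \<Rightarrow> real^'e \<Rightarrow> real^'e" where
  "neg_angle_sum X0 l = (\<chi> e. - (\<Sum>t\<in>UNIV. \<Sum>(i, j)\<in>{(i, j). i \<in> loc \<and> j \<in> loc \<and> i < j \<and> edg t i j = e}.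
        sgn (tvol X0 t) * dihedral_len (\<lambda>a b. l $ edg t a b) i j))"

definition f1 :: "real^3^'v \<Rightarrow> (real^3) \<times> (real^3) \<Rightarrow> real^3^'v" where
  "f1 X = (\<lambda>(a, b). \<chi> v. a + cross3 b (X $ v))"

definition f2 :: "real^3^'v \<Rightarrow> real^3^'v \<Rightarrow> real^'e" where
  "f2 X = frechet_derivative edge_lengths (at X)"

definition f3 :: "real^3^'v \<Rightarrow> real^'e \<Rightarrow> real^'e" where
  "f3 X = frechet_derivative (neg_angle_sum X) (at (edge_lengths X))"

definition f4 :: "real^3^'v \<Rightarrow> real^'e \<Rightarrow> real^3^'v" where
  "f4 X = (\<lambda>w. - adjoint (f2 X) w)"

definition f5 :: "real^3^'v \<Rightarrow> real^3^'v \<Rightarrow> (real^3) \<times> (real^3)" where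
  "f5 X = adjoint (f1 X)"

end

end

theory Submission
  imports Defs
begin

text \<open>
The relation f2 f1 = 0 says that rigid motions preserve lengths, and f5 f4 = 0 is its transpose.
Near the given lengths every tetrahedron is realizable, so the dihedral angles are smooth functions
of the lengths and can be differentiated through the cross products of edge vectors.

For f3 f2 = 0, move the vertices with some velocity.  The signed dihedral angle of ABCD at AB changes
at the rate r(D) - r(C), where r(P) is the angular velocity of the half plane ABP about AB.
Since r(P) depends only on the face ABP, and each face around an edge occurs in two tetrahedra with
opposite signs, the sum around an edge vanishes.

Within one tetrahedron the Jacobian of the dihedral angles by the edge lengths is symmetric, hence
f3 is symmetric, and f4 f3 = 0 is the transpose of f3 f2 = 0.
\<close>

section \<open>Dihedral angles in terms of squared edge lengths\<close>

text \<open>Six squared edge lengths s determine, for the edge vectors u, v, w from vertex h to k, f, g, the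
  numbers par2 = |u x v|^2, nrm2 = (u x v) . (u x w) and the Gram determinant of u, v, w.  The dihedral
  angle at hk is the angle between u x v and u x w; dangle is its differential in the direction d.\<close>
definition par2 :: "(nat \<Rightarrow> nat \<Rightarrow> real) \<Rightarrow> nat \<Rightarrow> nat \<Rightarrow> nat \<Rightarrow> real" where
  "par2 s h k f = s h k * s h f - ((s h k + s h f - s k f) / 2)\<^sup>2"

definition nrm2 :: "(nat \<Rightarrow> nat \<Rightarrow> real) \<Rightarrow> nat \<Rightarrow> nat \<Rightarrow> nat \<Rightarrow> nat \<Rightarrow> real" where
  "nrm2 s h k f g = s h k * ((s h f + s h g - s f g) / 2)
     - ((s h k + s h f - s k f) / 2) * ((s h k + s h g - s k g) / 2)"

definition gram_det :: "(nat \<Rightarrow> nat \<Rightarrow> real) \<Rightarrow> nat \<Rightarrow> nat \<Rightarrow> nat \<Rightarrow> nat \<Rightarrow> real" where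
  "gram_det s h k f g = s h k * s h f * s h g
     + (s h k + s h f - s k f) * (s h k + s h g - s k g) * (s h f + s h g - s f g) / 4
     - s h k * ((s h f + s h g - s f g) / 2)\<^sup>2
     - s h f * ((s h k + s h g - s k g) / 2)\<^sup>2
     - s h g * ((s h k + s h f - s k f) / 2)\<^sup>2"

text \<open>Sylvester's determinant identity for the Gram matrix of u, v, w: \<open>par2\<close> and
  \<open>nrm2\<close> are its 2x2 minors bordering the pivot \<open>s h k\<close>. It splits the
  denominator of \<open>dangle\<close> into sqrt(\<open>s h k\<close>) and a factor common to all
  edges of the tetrahedron.\<close>

lemma par2_nrm2_gram_det:
  "par2 s h k f * par2 s h k g - (nrm2 s h k f g)\<^sup>2 = s h k * gram_det s h k f g"
  unfolding par2_def nrm2_def gram_det_def power2_eq_square by (simp add: field_simps)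

text \<open>For the lengths of an actual tetrahedron this is 36 times the squared volume, hence
  independent of the naming of the vertices. The three adjacent transpositions generate all
  renamings.\<close>

lemma gram_det_swaps:
  assumes sym: "\<And>a b. s a b = s b a"
  shows "gram_det s k h f g = gram_det s h k f g" "gram_det s h f k g = gram_det s h k f g"
    "gram_det s h k g f = gram_det s h k f g"
proof -
  have e: "s k h = s h k" "s f k = s k f" "s g f = s f g" by (rule sym)+
  show "gram_det s k h f g = gram_det s h k f g" "gram_det s h f k g = gram_det s h k f g"
    "gram_det s h k g f = gram_det s h k f g"
    unfolding gram_det_def e power2_eq_square by (simp_all add: field_simps)
qed

lemma par2_swaps:
  assumes sym: "\<And>a b. s a b = s b a"
  shows "par2 s k h f = par2 s h k f" "par2 s h f k = par2 s h k f"
proof -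
  have e: "s k h = s h k" "s f k = s k f"  by (rule sym)+
  show "par2 s k h f = par2 s h k f" "par2 s h f k = par2 s h k f"
    unfolding par2_def e power2_eq_square by (simp_all add: field_simps)
qed

section \<open>Differentiating the dihedral angle\<close>

definition dpar2 :: "(nat \<Rightarrow> nat \<Rightarrow> real) \<Rightarrow> (nat \<Rightarrow> nat \<Rightarrow> real) \<Rightarrow> nat \<Rightarrow> nat \<Rightarrow> nat \<Rightarrow> real" where
  "dpar2 s d h k f = d h k * s h f + s h k * d h f
     - 2 * (((s h k + s h f - s k f) / 2) * ((d h k + d h f - d k f) / 2))"

definition dnrm2 :: "(nat \<Rightarrow> nat \<Rightarrow> real) \<Rightarrow> (nat \<Rightarrow> nat \<Rightarrow> real) \<Rightarrow> nat \<Rightarrow> nat \<Rightarrow> nat \<Rightarrow> nat \<Rightarrow> real" where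
  "dnrm2 s d h k f g = d h k * ((s h f + s h g - s f g) / 2) + s h k * ((d h f + d h g - d f g) / 2)
     - ((d h k + d h f - d k f) / 2) * ((s h k + s h g - s k g) / 2)
     - ((s h k + s h f - s k f) / 2) * ((d h k + d h g - d k g) / 2)"

definition dangle :: "(nat \<Rightarrow> nat \<Rightarrow> real) \<Rightarrow> (nat \<Rightarrow> nat \<Rightarrow> real) \<Rightarrow> nat \<Rightarrow> nat \<Rightarrow> nat \<Rightarrow> nat \<Rightarrow> real" where
  "dangle s d h k f g =
     (nrm2 s h k f g * (dpar2 s d h k f / (2 * par2 s h k f) + dpar2 s d h k g / (2 * par2 s h k g))
       - dnrm2 s d h k f g) / sqrt (par2 s h k f * par2 s h k g - (nrm2 s h k f g)\<^sup>2)"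

lemma par2_has_derivative:
  assumes "\<And>a b. ((\<lambda>x. s x a b) has_derivative (\<lambda>v. d v a b)) (at x)"
  shows "((\<lambda>x. par2 (s x) h k f) has_derivative (\<lambda>v. dpar2 (s x) (d v) h k f)) (at x)"
  unfolding par2_def dpar2_def power2_eq_square
  by (auto intro!: derivative_eq_intros assms simp: field_simps)

lemma nrm2_has_derivative:
  assumes "\<And>a b. ((\<lambda>x. s x a b) has_derivative (\<lambda>v. d v a b)) (at x)"
  shows "((\<lambda>x. nrm2 (s x) h k f g) has_derivative (\<lambda>v. dnrm2 (s x) (d v) h k f g)) (at x)"
  unfolding nrm2_def dnrm2_def
  by (auto intro!: derivative_eq_intros assms simp: field_simps)

text \<open>The terms a'/(2a) and b'/(2b) are the logarithmic derivatives of the two square roots;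
  the denominator is the sine of the angle times sqrt(ab). The last condition in \<open>pos\<close>
  is strict Cauchy-Schwarz and keeps the argument inside (-1, 1).\<close>

lemma arccos_quotient_has_derivative:
  fixes a b c :: "'a::real_normed_vector \<Rightarrow> real"
  assumes a: "(a has_derivative a') (at x)" and b: "(b has_derivative b') (at x)"
    and c: "(c has_derivative c') (at x)"
    and pos: "a x > 0" "b x > 0" "a x * b x - (c x)\<^sup>2 > 0"
  shows "((\<lambda>y. arccos (c y / (sqrt (a y) * sqrt (b y)))) has_derivative
     (\<lambda>v. (c x * (a' v / (2 * a x) + b' v / (2 * b x)) - c' v) / sqrt (a x * b x - (c x)\<^sup>2))) (at x)"
proof -
  define q where "q = sqrt (a x) * sqrt (b x)"
  have q: "q > 0" "q\<^sup>2 = a x * b x" using pos by (auto simp: q_def power_mult_distrib)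
  have lt: "(c x / q)\<^sup>2 < 1" using pos q by (simp add: power_divide)
  then have r: "-1 < c x / q" "c x / q < 1"
    by (auto simp: power2_less_1_iff abs_less_iff abs_square_less_1)
  have sin: "sqrt (1 - (c x / q)\<^sup>2) = sqrt (a x * b x - (c x)\<^sup>2) / q"
  proof -
    have "1 - (c x / q)\<^sup>2 = (a x * b x - (c x)\<^sup>2) / q\<^sup>2"
      using q pos by (simp add: power_divide field_simps)
    then show ?thesis using q(1) by (simp add: real_sqrt_divide)
  qed
  have A: "(arccos has_derivative (\<lambda>v. v * inverse (- sqrt (1 - (c x / q)\<^sup>2)))) (at (c x / q))"
    by (rule has_derivative_eq_rhs[OF DERIV_arccos[OF r, unfolded has_field_derivative_def]]) auto
  have sa: "((\<lambda>y. sqrt (a y)) has_derivative (\<lambda>v. a' v / (2 * sqrt (a x)))) (at x)"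
    using pos by (auto intro!: derivative_eq_intros a simp: field_simps)
  have sb: "((\<lambda>y. sqrt (b y)) has_derivative (\<lambda>v. b' v / (2 * sqrt (b x)))) (at x)"
    using pos by (auto intro!: derivative_eq_intros b simp: field_simps)
  define E where "E v = (c' v - c x * (a' v / (2 * a x) + b' v / (2 * b x))) / q" for v
  have F: "((\<lambda>y. c y / (sqrt (a y) * sqrt (b y))) has_derivative E) (at x)"
  proof -
    have sq: "a x = sqrt (a x) * sqrt (a x)" "b x = sqrt (b x) * sqrt (b x)" using pos by auto
    have "sqrt (a x) > 0" "sqrt (b x) > 0" using pos by auto
    \<comment> \<open>With the square roots named, \<open>a x\<close> and \<open>b x\<close> become
      squares and the quotient rule a rational identity.\<close>
    moreover have "E v = (c' v * (\<alpha> * \<beta>) - c x * (a' v / (2 * \<alpha>) * \<beta> + \<alpha> * (b' v / (2 * \<beta>)))) / ((\<alpha> * \<beta>) * (\<alpha> * \<beta>))"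
      if "\<alpha> = sqrt (a x)" "\<beta> = sqrt (b x)" for v \<alpha> \<beta>
    proof -
      have "\<alpha> > 0" "\<beta> > 0" "a x = \<alpha> * \<alpha>" "b x = \<beta> * \<beta>" using that pos by auto
      then show ?thesis unfolding E_def q_def that(1)[symmetric] that(2)[symmetric]
        by (simp add: divide_simps)
    qed
    ultimately show ?thesis
      by (intro has_derivative_eq_rhs[OF has_derivative_divide'[OF c has_derivative_mult[OF sa sb]]])
         (auto simp: fun_eq_iff algebra_simps)
  qed
  have "((\<lambda>y. arccos (c y / (sqrt (a y) * sqrt (b y)))) has_derivative
      (\<lambda>v. E v * inverse (- sqrt (1 - (c x / q)\<^sup>2)))) (at x)"
    using diff_chain_at[OF F] A by (simp add: o_def q_def)
  moreover have "E v * inverse (- sqrt (1 - (c x / q)\<^sup>2)) =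
      (c x * (a' v / (2 * a x) + b' v / (2 * b x)) - c' v) / sqrt (a x * b x - (c x)\<^sup>2)" for v
    unfolding sin using q pos
    by (simp add: E_def divide_simps)
  ultimately show ?thesis by simp
qed

lemma dangle_has_derivative:
  assumes d: "\<And>a b. ((\<lambda>x. s x a b) has_derivative (\<lambda>v. d v a b)) (at x)"
    and pos: "par2 (s x) h k f > 0" "par2 (s x) h k g > 0"
      "par2 (s x) h k f * par2 (s x) h k g - (nrm2 (s x) h k f g)\<^sup>2 > 0"
  shows "((\<lambda>y. arccos (nrm2 (s y) h k f g / (sqrt (par2 (s y) h k f) * sqrt (par2 (s y) h k g))))
     has_derivative (\<lambda>v. dangle (s x) (d v) h k f g)) (at x)"
  unfolding dangle_def
  by (rule arccos_quotient_has_derivative[OF par2_has_derivative[OF d] par2_has_derivative[OF d]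
        nrm2_has_derivative[OF d] pos])

text \<open>Up to the factor l_hk l_hf / sqrt (gram_det), this is the partial derivative of the dihedral
  angle at hk by the length of the adjacent edge hf.\<close>
definition corner :: "(nat \<Rightarrow> nat \<Rightarrow> real) \<Rightarrow> nat \<Rightarrow> nat \<Rightarrow> nat \<Rightarrow> nat \<Rightarrow> real" where
  "corner s h k f g =
    (let uu = s h k; vv = s h f; uv = (s h k + s h f - s k f) / 2;
         uw = (s h k + s h g - s k g) / 2; vw = (s h f + s h g - s f g) / 2
     in (uv\<^sup>2 - uu * vv + uw * vv + uu * vw - uv * uw - uv * vw) / par2 s h k f)"

text \<open>Exchanging the edge vectors u and v only permutes the terms of the numerator. Hence the
  angle at hk varies with the length of hf as the angle at hf does with the length of hk.\<close>

lemma corner_sym: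
  assumes sym: "\<And>a b. s a b = s b a"
  shows "corner s h k f g = corner s h f k g"
  unfolding corner_def Let_def par2_swaps(2)[of s, OF sym, of h f k]
  using sym[of f k] by (simp add: algebra_simps)

text \<open>The coefficient of d h k is the one forced by invariance of angles under scaling.\<close>
lemma dangle_coefficients:
  assumes sym: "\<And>a b. s a b = s b a" and dsym: "\<And>a b. d a b = d b a"
    and pos: "s h k > 0" "par2 s h k f > 0" "par2 s h k g > 0"
  shows "dangle s d h k f g = sqrt (s h k) / (2 * sqrt (gram_det s h k f g)) *
     (d f g + corner s h k f g * d h f + corner s k h f g * d k f
        + corner s h k g f * d h g + corner s k h g f * d k g
      - (s f g + corner s h k f g * s h f + corner s k h f g * s k f
        + corner s h k g f * s h g + corner s k h g f * s k g) / s h k * d h k)"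
proof -
  have e: "s k h = s h k" "s g f = s f g" "d k h = d h k" "d g f = d f g" by (rule sym dsym)+
  define p q where "p = par2 s h k f" and "q = par2 s h k g"
  have p0: "p > 0" "q > 0" using pos by (auto simp: p_def q_def)
  have P: "par2 s k h f = p" "par2 s k h g = q"
    unfolding p_def q_def by (rule par2_swaps[of s, OF sym])+
  have main: "(nrm2 s h k f g * (dpar2 s d h k f / (2 * p) + dpar2 s d h k g / (2 * q)) - dnrm2 s d h k f g)
    = s h k / 2 * (d f g + corner s h k f g * d h f + corner s k h f g * d k f
        + corner s h k g f * d h g + corner s k h g f * d k g
      - (s f g + corner s h k f g * s h f + corner s k h f g * s k f
        + corner s h k g f * s h g + corner s k h g f * s k g) / s h k * d h k)"
  proof -
    define uu vv ww uv uw vw where w: "uu = s h k" "vv = s h f" "ww = s h g"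
      "uv = (s h k + s h f - s k f) / 2" "uw = (s h k + s h g - s k g) / 2"
      "vw = (s h f + s h g - s f g) / 2"
    have s: "s h k = uu" "s h f = vv" "s h g = ww" "s k f = uu + vv - 2 * uv"
      "s k g = uu + ww - 2 * uw" "s f g = vv + ww - 2 * vw" by (simp_all add: w field_simps)
    \<comment> \<open>With the inverses as variables bound by the two relations \<open>I\<close> and
      \<open>J\<close> below, the claims on the coefficients become polynomial identities modulo
      these relations.\<close>
    define I J where "I = inverse p" and "J = inverse q"
    have pv: "p = uu * vv - uv * uv" and qv: "q = uu * ww - uw * uw"
      by (simp_all add: p_def q_def par2_def power2_eq_square w)
    have I: "(uu * vv - uv * uv) * I = 1" and J: "(uu * ww - uw * uw) * J = 1"
      using p0 by (simp_all add: I_def J_def pv qv)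
    define N where "N = uu * vw - uv * uw"
    have N: "nrm2 s h k f g = N" by (simp add: nrm2_def N_def w)
    define cf ckf cg ckg where c: "cf = corner s h k f g" "ckf = corner s k h f g"
      "cg = corner s h k g f" "ckg = corner s k h g f"
    have cI: "cf = (uv\<^sup>2 - uu * vv + uw * vv + uu * vw - uv * uw - uv * vw) * I"
      "cg = (uw\<^sup>2 - uu * ww + uv * ww + uu * vw - uv * uw - uw * vw) * J"
      "ckf = ((uu - uv)\<^sup>2 - uu * (uu + vv - 2 * uv) + (uu - uw) * (uu + vv - 2 * uv)
         + uu * (uu - uv - uw + vw) - (uu - uv) * (uu - uw) - (uu - uv) * (uu - uv - uw + vw)) * I"
      "ckg = ((uu - uw)\<^sup>2 - uu * (uu + ww - 2 * uw) + (uu - uv) * (uu + ww - 2 * uw)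
         + uu * (uu - uw - uv + vw) - (uu - uv) * (uu - uw) - (uu - uw) * (uu - uv - uw + vw)) * J"
      unfolding c corner_def Let_def p_def[symmetric] q_def[symmetric] P e s divide_inverse[of _ p]
        divide_inverse[of _ q] I_def[symmetric] J_def[symmetric]
      by (simp_all add: field_simps power2_eq_square)
    have 1: "uu * cf = N * (uu - uv) * I - (uu - uw)" "uu * ckf = N * uv * I - uw"
      "uu * cg = N * (uu - uw) * J - (uu - uv)" "uu * ckg = N * uw * J - uv"
      using I J unfolding cI N_def by algebra+
    \<comment> \<open>This evaluates the numerator of the coefficient of \<open>d h k\<close>. The
      positive factor \<open>uu\<close> is carried along so that the four formulas just obtained can
      be substituted.\<close>
    have "uu * ((vv + ww - 2 * vw) + cf * vv + ckf * (uu + vv - 2 * uv) + cg * ww + ckg * (uu + ww - 2 * uw))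
       = uu * (2 * vw - uw - uv - N * (vv - uv) * I - N * (ww - uw) * J)"
      using I J 1 unfolding N_def by algebra
    then have 2: "(vv + ww - 2 * vw) + cf * vv + ckf * (uu + vv - 2 * uv) + cg * ww + ckg * (uu + ww - 2 * uw)
       = 2 * vw - uw - uv - N * (vv - uv) * I - N * (ww - uw) * J"
      using pos(1) w(1) by simp
    have u0: "uu \<noteq> 0" using pos(1) w(1) by simp
    have R: "uu / 2 * (d f g + cf * d h f + ckf * d k f + cg * d h g + ckg * d k g - S / uu * d h k)
       = (uu * d f g + (uu * cf) * d h f + (uu * ckf) * d k f + (uu * cg) * d h g + (uu * ckg) * d k g - S * d h k) / 2"
       for S using u0 by (simp add: field_simps)
    have half: "x / (2 * p) = x * I / 2" "x / (2 * q) = x * J / 2" for x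
      by (simp_all add: I_def J_def field_simps)
    show ?thesis
      unfolding N c[symmetric] s R 2 1 half unfolding dpar2_def dnrm2_def s
      by (simp add: field_simps)
  qed
  have "s h k / 2 / sqrt (s h k * gram_det s h k f g) = sqrt (s h k) / (2 * sqrt (gram_det s h k f g))"
    using pos(1) by (simp add: real_sqrt_mult divide_simps)
  then have "s h k / 2 * B / sqrt (s h k * gram_det s h k f g)
      = sqrt (s h k) / (2 * sqrt (gram_det s h k f g)) * B" for B
    by (metis times_divide_eq_left)
  then show ?thesis
    unfolding dangle_def main[unfolded p_def q_def] unfolding par2_nrm2_gram_det .
qed

section \<open>Tetrahedra in space\<close>

definition sqd :: "(nat \<Rightarrow> real^3) \<Rightarrow> nat \<Rightarrow> nat \<Rightarrow> real" where
  "sqd P a b = (P a - P b) \<bullet> (P a - P b)"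

definition dsqd :: "(nat \<Rightarrow> real^3) \<Rightarrow> (nat \<Rightarrow> real^3) \<Rightarrow> nat \<Rightarrow> nat \<Rightarrow> real" where
  "dsqd P Y a b = 2 * ((P a - P b) \<bullet> (Y a - Y b))"

definition triple :: "real^3 \<Rightarrow> real^3 \<Rightarrow> real^3 \<Rightarrow> real^3 \<Rightarrow> real" where
  "triple A B C D = cross3 (B - A) (C - A) \<bullet> (D - A)"

text \<open>Angular velocity, about the line AB, of the half plane through AB and C, when the points
  move with velocities a, b, c.\<close>
definition azimuth_rate :: "real^3 \<Rightarrow> real^3 \<Rightarrow> real^3 \<Rightarrow> real^3 \<Rightarrow> real^3 \<Rightarrow> real^3 \<Rightarrow> real" where
  "azimuth_rate A B C a b c =
     (let n = cross3 (B - A) (C - A); n' = cross3 (b - a) (C - A) + cross3 (B - A) (c - a)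
      in ((B - A) \<bullet> cross3 n n') / (norm (B - A) * (n \<bullet> n)))"

text \<open>Exchanging A and B reverses the axis, while the face normal and its velocity both change
  sign and so keep their cross product.\<close>

lemma azimuth_rate_swap: "azimuth_rate B A C b a c = - azimuth_rate A B C a b c"
proof -
  have 1: "cross3 (A - B) (C - B) = - cross3 (B - A) (C - A)"
    by (simp add: cross3_simps)
  have 2: "cross3 (a - b) (C - B) + cross3 (A - B) (c - b)
     = - (cross3 (b - a) (C - A) + cross3 (B - A) (c - a))"
    by (simp add: cross3_simps)
  have 3: "cross3 (- x) (- y) = cross3 x y" for x y by (simp add: cross3_simps)
  have 4: "norm (A - B) = norm (B - A)" "(A - B) \<bullet> x = - ((B - A) \<bullet> x)" for x
    by (simp_all add: norm_minus_commute inner_diff_left)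
  have 5: "(- x) \<bullet> (- x) = x \<bullet> x" for x :: "real^3" by simp
  show ?thesis unfolding azimuth_rate_def Let_def 1 2 3 4 5 by simp
qed

text \<open>The law of cosines and its differential: they turn the half-sums in \<open>par2\<close>,
  \<open>nrm2\<close> and their differentials into inner products of edge vectors.\<close>

lemma polarization:
  "sqd P a b = (P b - P a) \<bullet> (P b - P a)"
  "(sqd P a b + sqd P a c - sqd P b c) / 2 = (P b - P a) \<bullet> (P c - P a)"
  "dsqd P Y a b = 2 * ((P b - P a) \<bullet> (Y b - Y a))"
  "(dsqd P Y a b + dsqd P Y a c - dsqd P Y b c) / 2
    = (Y b - Y a) \<bullet> (P c - P a) + (P b - P a) \<bullet> (Y c - Y a)"
  by (simp_all add: sqd_def dsqd_def inner_diff_left inner_diff_right inner_commute)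

lemma inner_cross3_cross3: "cross3 a b \<bullet> cross3 c d = (a \<bullet> c) * (b \<bullet> d) - (a \<bullet> d) * (b \<bullet> c)"
  by (simp add: dot_cross)

lemma par2_sqd: "par2 (sqd P) h k f = cross3 (P k - P h) (P f - P h) \<bullet> cross3 (P k - P h) (P f - P h)"
  unfolding par2_def polarization(2) unfolding polarization(1)[of P h] inner_cross3_cross3
  by (simp add: power2_eq_square inner_commute)

lemma nrm2_sqd: "nrm2 (sqd P) h k f g = cross3 (P k - P h) (P f - P h) \<bullet> cross3 (P k - P h) (P g - P h)"
  unfolding nrm2_def polarization(2) unfolding polarization(1)[of P h] inner_cross3_cross3
  by (simp add: inner_commute)

lemma dpar2_sqd: "dpar2 (sqd P) (dsqd P Y) h k f = 2 * (cross3 (P k - P h) (P f - P h) \<bullet>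
    (cross3 (Y k - Y h) (P f - P h) + cross3 (P k - P h) (Y f - Y h)))"
  unfolding dpar2_def polarization(2,4) unfolding polarization(1)[of P h] polarization(3)[of P Y h]
    inner_add_right inner_cross3_cross3
  by (simp add: inner_commute algebra_simps)

lemma dnrm2_sqd: "dnrm2 (sqd P) (dsqd P Y) h k f g =
    (cross3 (Y k - Y h) (P f - P h) + cross3 (P k - P h) (Y f - Y h)) \<bullet> cross3 (P k - P h) (P g - P h)
    + cross3 (P k - P h) (P f - P h) \<bullet> (cross3 (Y k - Y h) (P g - P h) + cross3 (P k - P h) (Y g - Y h))"
  unfolding dnrm2_def polarization(2,4) unfolding polarization(1)[of P h] polarization(3)[of P Y h]
    inner_add_right inner_add_left inner_cross3_cross3
  by (simp add: inner_commute algebra_simps)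

text \<open>Both face normals are orthogonal to the common edge u, so their cross product is a
  multiple of u.\<close>

lemma cross3_cross3_triple:
  "cross3 (cross3 u v) (cross3 u w) = (cross3 u v \<bullet> w) *\<^sub>R u"
  by (simp add: vec_eq_iff forall_3 cross3_def inner_vec_def sum_3 algebra_simps)

lemma par2_nrm2_triple:
  "par2 (sqd P) h k f * par2 (sqd P) h k g - (nrm2 (sqd P) h k f g)\<^sup>2
    = (triple (P h) (P k) (P f) (P g) * norm (P k - P h))\<^sup>2"
proof -
  have "(norm (cross3 a b))\<^sup>2 = (a \<bullet> a) * (b \<bullet> b) - (a \<bullet> b)\<^sup>2" for a b
    unfolding power2_norm_eq_inner unfolding inner_cross3_cross3 by (simp add: power2_eq_square inner_commute)
  from this[of "cross3 (P k - P h) (P f - P h)" "cross3 (P k - P h) (P g - P h)"]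
  show ?thesis unfolding par2_sqd nrm2_sqd cross3_cross3_triple triple_def
    by (simp add: power_mult_distrib)
qed

text \<open>The angle given by \<open>arccos\<close> is unsigned; the sign of the triple product
  tells which of the two half planes is ahead in the rotation about the edge. With that sign, the
  angle varies like the difference of their azimuths.\<close>

lemma dangle_sqd:
  assumes "triple (P h) (P k) (P f) (P g) \<noteq> 0"
  shows "dangle (sqd P) (dsqd P Y) h k f g = sgn (triple (P h) (P k) (P f) (P g)) *
     (azimuth_rate (P h) (P k) (P g) (Y h) (Y k) (Y g) - azimuth_rate (P h) (P k) (P f) (Y h) (Y k) (Y f))"
proof -
  define u m n where "u = P k - P h" and "m = cross3 u (P f - P h)" and "n = cross3 u (P g - P h)"
  define m' n' where "m' = cross3 (Y k - Y h) (P f - P h) + cross3 u (Y f - Y h)"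
    and "n' = cross3 (Y k - Y h) (P g - P h) + cross3 u (Y g - Y h)"
  define T where "T = triple (P h) (P k) (P f) (P g)"
  have mn: "cross3 m n = T *\<^sub>R u"
    by (simp add: m_def n_def cross3_cross3_triple T_def triple_def u_def)
  have T0: "T \<noteq> 0" using assms T_def by simp
  then have "u \<noteq> 0" by (auto simp: T_def triple_def u_def)
  have "cross3 m n \<noteq> 0" using mn T0 \<open>u \<noteq> 0\<close> by simp
  then have nz: "m \<noteq> 0" "n \<noteq> 0" by auto
  \<comment> \<open>By the Binet-Cauchy identity the numerator of \<open>dangle\<close> consists of
    inner products with \<open>cross3 m n\<close>, which by \<open>mn\<close> points along the edge:
    only components along the axis remain.\<close>
  have "(m \<bullet> n) * (2 * (m \<bullet> m') / (2 * (m \<bullet> m)) + 2 * (n \<bullet> n') / (2 * (n \<bullet> n))) - (m' \<bullet> n + m \<bullet> n')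
    = (cross3 m n \<bullet> cross3 n n') / (n \<bullet> n) - (cross3 m n \<bullet> cross3 m m') / (m \<bullet> m)"
    unfolding inner_cross3_cross3 using nz by (simp add: field_simps inner_commute)
  also have "\<dots> = T * (u \<bullet> cross3 n n' / (n \<bullet> n) - u \<bullet> cross3 m m' / (m \<bullet> m))"
    unfolding mn by (simp add: algebra_simps)
  finally have "dangle (sqd P) (dsqd P Y) h k f g
     = T * (u \<bullet> cross3 n n' / (n \<bullet> n) - u \<bullet> cross3 m m' / (m \<bullet> m)) / (\<bar>T\<bar> * norm u)"
    unfolding dangle_def par2_nrm2_triple unfolding par2_sqd nrm2_sqd dpar2_sqd dnrm2_sqd
    by (simp add: m_def n_def m'_def n'_def u_def T_def abs_mult)
  also have "\<dots> = sgn T * (u \<bullet> cross3 n n' / (norm u * (n \<bullet> n)) - u \<bullet> cross3 m m' / (norm u * (m \<bullet> m)))"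
    using T0 \<open>u \<noteq> 0\<close> nz by (simp add: sgn_if field_simps)
  finally show ?thesis
    by (simp add: azimuth_rate_def Let_def m_def n_def m'_def n'_def u_def T_def)
qed

section \<open>Dihedral angles of points, and realization of given lengths by points\<close>

lemma perp_to_inner:
  "perp_to u v \<bullet> perp_to u w = v \<bullet> w - (u \<bullet> v) * (u \<bullet> w) / (u \<bullet> u)"
  by (cases "u = 0") (auto simp: perp_to_def inner_diff_left inner_diff_right inner_commute field_simps)

text \<open>Taking the cross product with u rotates the component orthogonal to u by a quarter turn
  and scales it by |u|, so the normals of the two faces enclose the same angle as these
  components.\<close>

lemma dihedral_pts_eq:
  assumes "P h \<noteq> P k"
  shows "dihedral_pts (P h) (P k) (P f) (P g) =
    arccos (nrm2 (sqd P) h k f g / (sqrt (par2 (sqd P) h k f) * sqrt (par2 (sqd P) h k g)))"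
proof -
  define u v w where "u = P k - P h" and "v = P f - P h" and "w = P g - P h"
  have u: "u \<bullet> u > 0" using assms by (simp add: u_def)
  have "perp_to u v \<bullet> perp_to u w = (cross3 u v \<bullet> cross3 u w) / (u \<bullet> u)" for v w
    unfolding perp_to_inner inner_cross3_cross3 using u by (simp add: field_simps inner_commute)
  then show ?thesis
    unfolding dihedral_pts_def Let_def norm_eq_sqrt_inner par2_sqd nrm2_sqd
      u_def[symmetric] v_def[symmetric] w_def[symmetric]
    using u by (simp add: real_sqrt_divide)
qed

text \<open>The realization is the Cholesky factorization of the Gram matrix.\<close>
lemma realizable:
  assumes sym: "\<And>a b. ell a b = ell b a" and pos: "\<And>a b. a \<in> loc \<Longrightarrow> b \<in> loc \<Longrightarrow> a \<noteq> b \<Longrightarrow> ell a b > 0"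
  defines "s \<equiv> \<lambda>a b. (ell a b)\<^sup>2"
  assumes par: "par2 s 0 1 2 > 0"
    and gram: "par2 s 0 1 2 * par2 s 0 1 3 - (nrm2 s 0 1 2 3)\<^sup>2 > 0"
  shows "\<exists>P. realizes ell P"
proof -
  define uu vv ww uv uw vw where w: "uu = s 0 1" "vv = s 0 2" "ww = s 0 3"
      "uv = (s 0 1 + s 0 2 - s 1 2) / 2" "uw = (s 0 1 + s 0 3 - s 1 3) / 2"
      "vw = (s 0 2 + s 0 3 - s 2 3) / 2"
  \<comment> \<open>The diagonal Cholesky entries are p, q / p and r / (p q). The last one is right
    because r^2 equals \<open>uu\<close> times the Gram determinant, by
    \<open>par2_nrm2_gram_det\<close>.\<close>
  define p q r where "p = sqrt uu" "q = sqrt (par2 s 0 1 2)"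
    "r = sqrt (par2 s 0 1 2 * par2 s 0 1 3 - (nrm2 s 0 1 2 3)\<^sup>2)"
  have uu: "uu > 0" using pos[of 0 1] by (simp add: w s_def loc_def)
  have pqr: "p > 0" "q > 0" "r > 0" using uu par gram by (auto simp: p_q_r_def)
  have G: "par2 s 0 1 2 = uu * vv - uv * uv" "par2 s 0 1 3 = uu * ww - uw * uw"
    "nrm2 s 0 1 2 3 = uu * vw - uv * uw"
    unfolding w par2_def nrm2_def power2_eq_square by simp_all
  have sq: "p * p = uu" "q * q = uu * vv - uv * uv"
    "r * r = (uu * vv - uv * uv) * (uu * ww - uw * uw) - (uu * vw - uv * uw)\<^sup>2"
    using uu par gram unfolding p_q_r_def G by simp_all
  define P :: "nat \<Rightarrow> real^3" where "P = (\<lambda>a. if a = 0 then 0 else if a = 1 then vector [p, 0, 0]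
     else if a = 2 then vector [uv / p, q / p, 0]
     else vector [uw / p, (uu * vw - uv * uw) / (p * q), r / (p * q)])"
  have i: "P 1 \<bullet> P 1 = uu" "P 2 \<bullet> P 2 = vv" "P 3 \<bullet> P 3 = ww" "P 1 \<bullet> P 2 = uv" "P 1 \<bullet> P 3 = uw" "P 2 \<bullet> P 3 = vw"
  proof -
    have nz: "p \<noteq> 0" "q \<noteq> 0" "uu \<noteq> 0" using pqr uu by auto
    have P: "P 1 = vector [p, 0, 0]" "P 2 = vector [uv / p, q / p, 0]"
      "P 3 = vector [uw / p, (uu * vw - uv * uw) / (p * q), r / (p * q)]"
      by (simp_all add: P_def)
    have I: "vector [a, b, c] \<bullet> (vector [x, y, z] :: real^3) = a * x + b * y + c * z" for a b c x y z :: real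
      by (simp add: inner_vec_def sum_3)
    show "P 1 \<bullet> P 1 = uu" "P 1 \<bullet> P 2 = uv" "P 1 \<bullet> P 3 = uw"
      unfolding P I using sq nz by simp_all
    have "uv / p * (uv / p) + q / p * (q / p) + 0 * 0 = (uv * uv + q * q) / (p * p)"
      by (simp add: add_divide_distrib)
    also have "\<dots> = vv" unfolding sq using nz by simp
    finally show "P 2 \<bullet> P 2 = vv" unfolding P I .
    have "uv / p * (uw / p) + q / p * ((uu * vw - uv * uw) / (p * q)) + 0 * (r / (p * q))
       = (uv * uw + (uu * vw - uv * uw)) / (p * p)"
      using nz by (simp add: field_simps)
    also have "\<dots> = vw" unfolding sq using nz by simp
    finally show "P 2 \<bullet> P 3 = vw" unfolding P I .
    have "uw / p * (uw / p) + (uu * vw - uv * uw) / (p * q) * ((uu * vw - uv * uw) / (p * q)) + r / (p * q) * (r / (p * q))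
      = (uw * uw * (q * q) + (uu * vw - uv * uw)\<^sup>2 + r * r) / ((p * p) * (q * q))"
      using nz by (simp add: field_simps power2_eq_square)
    also have "uw * uw * (q * q) + (uu * vw - uv * uw)\<^sup>2 + r * r = ww * ((p * p) * (q * q))"
      unfolding sq by (simp add: algebra_simps)
    finally show "P 3 \<bullet> P 3 = ww" unfolding P I using nz by simp
  qed
  have P0: "P 0 = 0" by (simp add: P_def)
  have D: "(dist (P a) (P b))\<^sup>2 = P a \<bullet> P a + P b \<bullet> P b - 2 * (P a \<bullet> P b)" for a b
    by (simp add: dist_norm power2_norm_eq_inner inner_diff_left inner_diff_right inner_commute)
  have S: "dist (P a) (P b) = ell a b" if "a < b" "b < 4" for a b
  proof -
    have "(dist (P a) (P b))\<^sup>2 = (ell a b)\<^sup>2"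
    proof -
      have "(a, b) \<in> {(0,1),(0,2),(0,3),(1,2),(1,3),(2,3)}"
        using that by (auto simp: numeral_eq_Suc less_Suc_eq)
      then show ?thesis unfolding D using i
        by (auto simp: P0 w s_def)
    qed
    moreover have "ell a b > 0" using pos[of a b] that by (simp add: loc_def)
    ultimately show ?thesis by simp
  qed
  have "realizes ell P" unfolding realizes_def
  proof (intro ballI impI)
    fix a b assume "a \<in> loc" "b \<in> loc" "a \<noteq> (b::nat)"
    then show "dist (P a) (P b) = ell a b"
      using S[of a b] S[of b a] sym[of a b] by (cases "a < b") (auto simp: loc_def dist_commute)
  qed
  then show ?thesis by blast
qed

section \<open>Combinatorics of face gluings\<close>

lemma loc_eq: "loc = {0, 1, 2, 3}"
  by (auto simp: loc_def numeral_eq_Suc less_Suc_eq)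

lemma others:
  "other1 0 1 = 2" "other2 0 1 = 3" "other1 0 2 = 1" "other2 0 2 = 3" "other1 0 3 = 1" "other2 0 3 = 2"
  "other1 1 2 = 0" "other2 1 2 = 3" "other1 1 3 = 0" "other2 1 3 = 2" "other1 2 3 = 0" "other2 2 3 = 1"
  unfolding other1_def other2_def
  by (rule Least_equality Greatest_equality; auto simp: loc_eq)+

lemma local_edges: "{(i, j). i \<in> loc \<and> j \<in> loc \<and> i < j} = {(0,1),(0,2),(0,3),(1,2),(1,3),(2,3)}"
  by (auto simp: loc_eq)

lemma sum_local_edges:
  fixes F :: "nat \<Rightarrow> nat \<Rightarrow> 'b::comm_monoid_add"
  shows "(\<Sum>(i, j)\<in>{(i, j). i \<in> loc \<and> j \<in> loc \<and> i < j \<and> Q i j}. F i j) =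
    (if Q 0 1 then F 0 1 else 0) + (if Q 0 2 then F 0 2 else 0) + (if Q 0 3 then F 0 3 else 0)
    + (if Q 1 2 then F 1 2 else 0) + (if Q 1 3 then F 1 3 else 0) + (if Q 2 3 then F 2 3 else 0)"
proof -
  let ?L = "{(0::nat, 1::nat), (0,2), (0,3), (1,2), (1,3), (2,3)}"
  have "{(i, j). i \<in> loc \<and> j \<in> loc \<and> i < j \<and> Q i j} = {z \<in> ?L. case z of (i, j) \<Rightarrow> Q i j}"
    unfolding local_edges[symmetric] by auto
  note eq = this
  have "(\<Sum>(i, j)\<in>{(i, j). i \<in> loc \<and> j \<in> loc \<and> i < j \<and> Q i j}. F i j)
      = (\<Sum>z\<in>?L. if case z of (i, j) \<Rightarrow> Q i j then case z of (i, j) \<Rightarrow> F i j else 0)"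
    unfolding eq by (rule sum.inter_filter) simp
  also have "\<dots> = (\<Sum>(i, j)\<in>?L. if Q i j then F i j else 0)"
    by (intro sum.cong) auto
  finally show ?thesis by (simp add: add.assoc)
qed

text \<open>A permutation encodes an oriented edge (\<sigma> 0, \<sigma> 1) and a face through it
  with third vertex \<sigma> 3. Reversing the edge changes both the sign and K, so the two
  orientations contribute equally: hence the factor 2 and twelve terms, two faces for each of six
  edges.\<close>

lemma sum_permutations_loc:
  fixes K :: "nat \<Rightarrow> nat \<Rightarrow> nat \<Rightarrow> real"
  assumes K: "\<And>i j m. K j i m = - K i j m"
  shows "(\<Sum>\<sigma>\<in>{\<sigma>. \<sigma> permutes loc}. of_int (sign \<sigma>) * K (\<sigma> 0) (\<sigma> 1) (\<sigma> 3)) =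
    2 * ((K 0 1 3 - K 0 1 2) - (K 0 2 3 - K 0 2 1) + (K 0 3 2 - K 0 3 1)
       + (K 1 2 3 - K 1 2 0) - (K 1 3 2 - K 1 3 0) + (K 2 3 1 - K 2 3 0))"
proof -
  have f: "finite {1::nat, 2, 3}" "0 \<notin> {1::nat, 2, 3}" "finite {2::nat, 3}" "1 \<notin> {2::nat, 3}"
    "finite {3::nat}" "2 \<notin> {3::nat}" by auto
  have "(\<Sum>\<sigma>\<in>{\<sigma>. \<sigma> permutes {0::nat, 1, 2, 3}}. of_int (sign \<sigma>) * K (\<sigma> 0) (\<sigma> 1) (\<sigma> 3)) =
    2 * ((K 0 1 3 - K 0 1 2) - (K 0 2 3 - K 0 2 1) + (K 0 3 2 - K 0 3 1)
       + (K 1 2 3 - K 1 2 0) - (K 1 3 2 - K 1 3 0) + (K 2 3 1 - K 2 3 0))"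
    unfolding sum_over_permutations_insert[OF f(1,2)] sum_over_permutations_insert[OF f(3,4)]
      sum_over_permutations_insert[OF f(5,6)] permutes_sing
    using K[of 0 1] K[of 0 2] K[of 0 3] K[of 1 2] K[of 1 3] K[of 2 3]
    by (simp add: sign_swap_id permutation_swap_id permutation_compose sign_compose sign_id transpose_def
        permutation_id del: One_nat_def)
  then show ?thesis unfolding loc_eq .
qed

section \<open>Consequences of the gluing rules, and cancellation across faces\<close>

locale triangulation =
  fixes glue :: "'t::finite \<Rightarrow> nat \<Rightarrow> 't"
    and gperm :: "'t \<Rightarrow> nat \<Rightarrow> nat \<Rightarrow> nat"
    and vtx :: "'t \<Rightarrow> nat \<Rightarrow> 'v::finite"
    and edg :: "'t \<Rightarrow> nat \<Rightarrow> nat \<Rightarrow> 'e::finite"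
  assumes manifold: "closed_oriented_triangulated_3manifold glue gperm vtx edg"
begin

lemma gperm_permutes: "f \<in> loc \<Longrightarrow> gperm t f permutes loc"
  using manifold unfolding closed_oriented_triangulated_3manifold_def
  by (intro bij_imp_permutes) auto

lemma glue_glue: "f \<in> loc \<Longrightarrow> glue (glue t f) (gperm t f f) = t"
  using manifold unfolding closed_oriented_triangulated_3manifold_def by simp

text \<open>Outside \<open>loc\<close> both permutations are the identity, so the relation holds for
  every index; \<open>flag_sum_zero\<close> needs it as an equality of functions.\<close>

lemma gperm_gperm:
  assumes f: "f \<in> loc"
  shows "gperm (glue t f) (gperm t f f) (gperm t f i) = i"
proof (cases "i \<in> loc")
  case True
  then show ?thesis using manifold f unfolding closed_oriented_triangulated_3manifold_def by simp
next
  case False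
  have "gperm t f f \<in> loc" using gperm_permutes[OF f] f by (simp add: permutes_in_image)
  with False gperm_permutes f show ?thesis by (metis permutes_not_in)
qed

lemma sign_gperm: "f \<in> loc \<Longrightarrow> sign (gperm t f) = - 1"
  using manifold unfolding closed_oriented_triangulated_3manifold_def by (simp add: sign_def)

lemma vtx_glue: "f \<in> loc \<Longrightarrow> i \<in> loc \<Longrightarrow> i \<noteq> f \<Longrightarrow> vtx (glue t f) (gperm t f i) = vtx t i"
  using manifold unfolding closed_oriented_triangulated_3manifold_def by simp

lemma edg_glue:
  "f \<in> loc \<Longrightarrow> i \<in> loc \<Longrightarrow> j \<in> loc \<Longrightarrow> i \<noteq> f \<Longrightarrow> j \<noteq> f \<Longrightarrow> i \<noteq> j \<Longrightarrow>
    edg (glue t f) (gperm t f i) (gperm t f j) = edg t i j"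
  using manifold unfolding closed_oriented_triangulated_3manifold_def by simp

lemma edg_commute: "edg t i j = edg t j i"
  using manifold unfolding closed_oriented_triangulated_3manifold_def by simp

lemma edg_surj: "\<exists>t i j. i \<in> loc \<and> j \<in> loc \<and> i \<noteq> j \<and> edg t i j = e"
proof -
  have "\<forall>e. \<exists>t. \<exists>i\<in>loc. \<exists>j\<in>loc. i \<noteq> j \<and> edg t i j = e"
    using manifold unfolding closed_oriented_triangulated_3manifold_def by (elim conjE)
  then show ?thesis by blast
qed

lemma edg_classes:
  assumes "edg t i j = edg t' k m" "i \<in> loc" "j \<in> loc" "k \<in> loc" "m \<in> loc" "i \<noteq> j" "k \<noteq> m"
  shows "((t, i, j), (t', k, m)) \<in> (erel glue gperm)\<^sup>* \<or> ((t, i, j), (t', m, k)) \<in> (erel glue gperm)\<^sup>*"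
proof -
  have "\<forall>t t' i j k m. i \<in> loc \<longrightarrow> j \<in> loc \<longrightarrow> k \<in> loc \<longrightarrow> m \<in> loc \<longrightarrow> i \<noteq> j \<longrightarrow> k \<noteq> m \<longrightarrow>
        edg t i j = edg t' k m \<longrightarrow>
        ((t, i, j), (t', k, m)) \<in> (erel glue gperm)\<^sup>* \<or> ((t, i, j), (t', m, k)) \<in> (erel glue gperm)\<^sup>*"
    using manifold unfolding closed_oriented_triangulated_3manifold_def by (elim conjE)
  with assms show ?thesis by blast
qed

lemma erel_vtx:
  assumes "(p, q) \<in> (erel glue gperm)\<^sup>*"
  shows "(case q of (t, i, j) \<Rightarrow> (vtx t i, vtx t j)) = (case p of (t, i, j) \<Rightarrow> (vtx t i, vtx t j))"
  using assms by induction (auto simp: erel_def vtx_glue)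

text \<open>Identified local edges have the same end vertices up to order. This makes edge lengths
  independent of the representative chosen in \<open>edge_lengths\<close>.\<close>

lemma edge_ends:
  assumes "edg t i j = edg t' k m" "i \<in> loc" "j \<in> loc" "k \<in> loc" "m \<in> loc" "i \<noteq> j" "k \<noteq> m"
  shows "dist (Y $ vtx t i) (Y $ vtx t j) = dist (Y $ vtx t' k) (Y $ vtx t' m)"
  using edg_classes[OF assms] by (auto dest!: erel_vtx simp: dist_commute)

lemma edge_lengths_nth:
  assumes "i \<in> loc" "j \<in> loc" "i \<noteq> j"
  shows "edge_lengths vtx edg Y $ edg t i j = dist (Y $ vtx t i) (Y $ vtx t j)"
proof -
  let ?Q = "\<lambda>(t', i', j'). i' \<in> loc \<and> j' \<in> loc \<and> i' \<noteq> j' \<and> edg t' i' j' = edg t i j"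
  obtain t' i' j' where e: "(SOME x. ?Q x) = (t', i', j')" by (cases "SOME x. ?Q x")
  have "?Q (SOME x. ?Q x)" by (rule someI[of ?Q "(t, i, j)"]) (use assms in simp)
  then have "i' \<in> loc" "j' \<in> loc" "i' \<noteq> j'" "edg t' i' j' = edg t i j" unfolding e by auto
  then show ?thesis unfolding edge_lengths_def vec_lambda_beta e using edge_ends[of t' i' j' t i j Y] assms by simp
qed

text \<open>Crossing the face opposite the local vertex \<sigma> 2 is an involution of the pairs (t, \<sigma>); it fixes the
  vertices seen by H and reverses the sign of \<sigma>.\<close>
lemma flag_sum_zero:
  fixes H :: "'v \<Rightarrow> 'v \<Rightarrow> 'v \<Rightarrow> real"
  shows "(\<Sum>t\<in>UNIV. \<Sum>\<sigma>\<in>{\<sigma>. \<sigma> permutes loc}. of_int (sign \<sigma>) *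
     (if edg t (\<sigma> 0) (\<sigma> 1) = e then H (vtx t (\<sigma> 0)) (vtx t (\<sigma> 1)) (vtx t (\<sigma> 3)) else 0)) = 0"
proof -
  define G where "G = (\<lambda>(t, \<sigma>). of_int (sign \<sigma>) *
     (if edg t (\<sigma> 0) (\<sigma> 1) = e then H (vtx t (\<sigma> 0)) (vtx t (\<sigma> 1)) (vtx t (\<sigma> 3)) else 0))"
  define \<phi> where "\<phi> = (\<lambda>(t, \<sigma>). (glue t (\<sigma> (2::nat)), gperm t (\<sigma> 2) \<circ> \<sigma>))"
  define A where "A = (UNIV :: 't set) \<times> {\<sigma>. \<sigma> permutes loc}"
  have in_loc: "\<sigma> i \<in> loc" if "\<sigma> permutes loc" "i < 4" for \<sigma> :: "nat \<Rightarrow> nat" and i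
    using that by (metis lessThan_iff loc_def permutes_in_image)
  have \<phi>A: "\<phi> x \<in> A" if "x \<in> A" for x
    using that in_loc gperm_permutes by (auto simp: A_def \<phi>_def intro!: permutes_compose)
  have \<phi>\<phi>: "\<phi> (\<phi> x) = x" if "x \<in> A" for x
    using that in_loc by (auto simp: A_def \<phi>_def glue_glue gperm_gperm fun_eq_iff)
  \<comment> \<open>The corners \<sigma> 0, \<sigma> 1, \<sigma> 3 lie on the crossed face, so the
    gluing preserves the edge and the three vertices; the odd gluing permutation contributes the
    factor -1.\<close>
  have G\<phi>: "G (\<phi> x) = - G x" if "x \<in> A" for x
  proof -
    obtain t \<sigma> where x: "x = (t, \<sigma>)" by (cases x)
    with that have p: "\<sigma> permutes loc" by (simp add: A_def)
    then have l: "\<sigma> 0 \<in> loc" "\<sigma> 1 \<in> loc" "\<sigma> 2 \<in> loc" "\<sigma> 3 \<in> loc" by (auto intro: in_loc)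
    have ne: "\<sigma> 0 \<noteq> \<sigma> 2" "\<sigma> 1 \<noteq> \<sigma> 2" "\<sigma> 3 \<noteq> \<sigma> 2" "\<sigma> 0 \<noteq> \<sigma> 1"
      using permutes_inj[OF p] by (simp_all add: inj_eq)
    have fin: "finite loc" by (simp add: loc_def)
    have "sign (gperm t (\<sigma> 2) \<circ> \<sigma>) = - sign \<sigma>"
      using sign_compose[OF permutes_imp_permutation[OF fin gperm_permutes[OF l(3)]] permutes_imp_permutation[OF fin p]]
      by (simp add: sign_gperm l)
    then show ?thesis using l ne by (simp add: x G_def \<phi>_def edg_glue vtx_glue del: One_nat_def)
  qed
  have "sum G A = sum (\<lambda>x. - G x) A"
    by (rule sum.reindex_bij_witness[of _ \<phi> \<phi>]) (simp_all add: \<phi>A \<phi>\<phi> G\<phi>)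
  then have "sum G A = 0" by (simp add: sum_negf)
  then show ?thesis unfolding A_def G_def sum.cartesian_product .
qed

end

section \<open>Symmetry of the angle Jacobian\<close>

text \<open>The six edges, each followed by the opposite edge.\<close>
abbreviation local_quads :: "(nat \<times> nat \<times> nat \<times> nat) set" where
  "local_quads \<equiv> {(0,1,2,3), (0,2,1,3), (0,3,1,2), (1,2,0,3), (1,3,0,2), (2,3,0,1)}"

text \<open>Entries for opposite edges carry the symmetric product of their two lengths, entries for
  adjacent edges are symmetric by \<open>corner_sym\<close>, and all share the factor 1 /
  sqrt(\<open>gram_det\<close>).\<close>

lemma dangle_form_symmetric:
  fixes l :: "nat \<Rightarrow> nat \<Rightarrow> real"
  defines "s \<equiv> \<lambda>x y. (l x y)\<^sup>2"
  defines "D \<equiv> \<lambda>a. dangle s (\<lambda>x y. 2 * l x y * a x y)"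
  defines "Q \<equiv> \<lambda>a b. D a 0 1 2 3 * b 0 1 + D a 0 2 1 3 * b 0 2 + D a 0 3 1 2 * b 0 3
      + D a 1 2 0 3 * b 1 2 + D a 1 3 0 2 * b 1 3 + D a 2 3 0 1 * b (2::nat) (3::nat)"
  assumes l: "\<And>x y. l x y = l y x" and a: "\<And>x y. a x y = a y x" and b: "\<And>x y. b x y = b y x"
    and pos: "\<And>h k f g. (h, k, f, g) \<in> local_quads \<Longrightarrow>
       l h k > 0 \<and> par2 s h k f > 0 \<and> par2 s h k g > 0"
  shows "Q a b = Q b a"
proof -
  have s: "s x y = s y x" for x y by (simp add: s_def l[of x y])
  define G where "G = 1 / (2 * sqrt (gram_det s 0 1 2 3))"
  define c where "c = corner s"
  have D: "D a h k f g = l h k * G * (2 * l f g * a f g + c h k f g * (2 * l h f * a h f)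
      + c k h f g * (2 * l k f * a k f) + c h k g f * (2 * l h g * a h g) + c k h g f * (2 * l k g * a k g)
      - E h k f g * (2 * l h k * a h k))"
    if a: "\<And>x y. a x y = a y x" and hkfg: "(h, k, f, g) \<in> local_quads"
      and E: "E = (\<lambda>h k f g. (s f g + c h k f g * s h f + c k h f g * s k f
        + c h k g f * s h g + c k h g f * s k g) / s h k)" for a h k f g E
  proof -
    note gr = gram_det_swaps[of s, OF s]
    have "gram_det s 0 2 1 3 = gram_det s 0 1 2 3" by (rule gr(2))
    moreover have "gram_det s 0 3 1 2 = gram_det s 0 1 2 3" by (rule trans[OF gr(2) gr(3)])
    moreover have "gram_det s 1 2 0 3 = gram_det s 0 1 2 3" by (rule trans[OF gr(2) gr(1)])
    moreover have "gram_det s 1 3 0 2 = gram_det s 0 1 2 3"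
      by (rule trans[OF gr(2) trans[OF gr(1) gr(3)]])
    moreover have "gram_det s 2 3 0 1 = gram_det s 0 1 2 3"
      by (rule trans[OF gr(2) trans[OF gr(1) trans[OF gr(3) gr(2)]]])
    ultimately have "gram_det s h k f g = gram_det s 0 1 2 3"
      using hkfg by (elim insertE) (simp_all del: One_nat_def)
    moreover have p: "s h k > 0" "par2 s h k f > 0" "par2 s h k g > 0" and "sqrt (s h k) = l h k"
      using pos[OF hkfg] by (auto simp: s_def)
    moreover have d: "2 * l x y * a x y = 2 * l y x * a y x" for x y
      by (simp add: l[of x y] a[of x y])
    ultimately show ?thesis
      using dangle_coefficients[of s "\<lambda>x y. 2 * l x y * a x y", OF s d p]
      unfolding D_def E c_def G_def by simp
  qed
  \<comment> \<open>\<open>E\<close> occurs only in the diagonal products of \<open>a h k\<close>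
    and \<open>b h k\<close>, which are symmetric whatever its value, so it can stay folded.\<close>
  define E where E: "E = (\<lambda>h k f g. (s f g + c h k f g * s h f + c k h f g * s k f
        + c h k g f * s h g + c k h g f * s k g) / s h k)"
  note D' = D[OF _ _ E]
  have c: "c h k f g = c h f k g" for h k f g unfolding c_def by (rule corner_sym[of s, OF s])
  note cs = c[of 0 2 1 3] c[of 0 3 1 2] c[of 0 3 2 1] c[of 1 2 0 3] c[of 1 3 0 2] c[of 1 3 2 0]
    c[of 2 1 0 3] c[of 2 3 0 1] c[of 2 3 1 0] c[of 3 1 0 2] c[of 3 2 0 1] c[of 3 2 1 0]
  note ls = l[of 1 0] l[of 2 0] l[of 3 0] l[of 2 1] l[of 3 1] l[of 3 2]
    a[of 1 0] a[of 2 0] a[of 3 0] a[of 2 1] a[of 3 1] a[of 3 2]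
    b[of 1 0] b[of 2 0] b[of 3 0] b[of 2 1] b[of 3 1] b[of 3 2]
  show ?thesis
    unfolding Q_def
    by (simp only: D'[OF a, of 0 1 2 3] D'[OF a, of 0 2 1 3] D'[OF a, of 0 3 1 2] D'[OF a, of 1 2 0 3]
       D'[OF a, of 1 3 0 2] D'[OF a, of 2 3 0 1]
       D'[OF b, of 0 1 2 3] D'[OF b, of 0 2 1 3] D'[OF b, of 0 3 1 2] D'[OF b, of 1 2 0 3]
       D'[OF b, of 1 3 0 2] D'[OF b, of 2 3 0 1] insert_iff simp_thms cs ls)
      (simp only: algebra_simps)
qed

section \<open>Dihedral angles as functions of the lengths, and signs of volumes\<close>

lemma par2_cong:
  assumes "s h k = s' h k" "s h f = s' h f" "s k f = s' k f"
  shows "par2 s h k f = par2 s' h k f"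
  unfolding par2_def assms ..

lemma nrm2_cong:
  assumes "s h k = s' h k" "s h f = s' h f" "s h g = s' h g" "s k f = s' k f" "s k g = s' k g"
    "s f g = s' f g"
  shows "nrm2 s h k f g = nrm2 s' h k f g"
  unfolding nrm2_def assms ..

lemma dangle_cong:
  assumes "s h k = s' h k" "s h f = s' h f" "s h g = s' h g" "s k f = s' k f" "s k g = s' k g"
    "s f g = s' f g" "d h k = d' h k" "d h f = d' h f" "d h g = d' h g" "d k f = d' k f" "d k g = d' k g"
    "d f g = d' f g"
  shows "dangle s d h k f g = dangle s' d' h k f g"
  unfolding dangle_def par2_def nrm2_def dpar2_def dnrm2_def assms ..

lemma local_quad:
  assumes "i \<in> loc" "j \<in> loc" "i < j"
  shows "(i, j, other1 i j, other2 i j) \<in> local_quads"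
    and "distinct [i, j, other1 i j, other2 i j]" and "{i, j, other1 i j, other2 i j} \<subseteq> loc"
proof -
  have "(i, j) \<in> {(i, j). i \<in> loc \<and> j \<in> loc \<and> i < j}" using assms by simp
  then have "(i, j) \<in> {(0,1),(0,2),(0,3),(1,2),(1,3),(2,3)}" unfolding local_edges .
  then show "(i, j, other1 i j, other2 i j) \<in> local_quads"
    and "distinct [i, j, other1 i j, other2 i j]" and "{i, j, other1 i j, other2 i j} \<subseteq> loc"
    by (elim insertE; simp add: others loc_eq del: One_nat_def)+
qed

text \<open>The angle formula involves the points only through their mutual distances, so the
  realization picked by \<open>SOME\<close> does not matter.\<close>

lemma dihedral_len_eq:
  fixes ell :: "nat \<Rightarrow> nat \<Rightarrow> real"
  defines "s \<equiv> \<lambda>a b. (ell a b)\<^sup>2"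
  assumes ex: "\<exists>P. realizes ell P" and ij: "i \<in> loc" "j \<in> loc" "i < j" and nz: "ell i j \<noteq> 0"
  shows "dihedral_len ell i j = arccos (nrm2 s i j (other1 i j) (other2 i j) /
     (sqrt (par2 s i j (other1 i j)) * sqrt (par2 s i j (other2 i j))))"
proof -
  define P where "P = (SOME P. realizes ell P)"
  have P: "realizes ell P" unfolding P_def using ex by (rule someI_ex)
  have sq: "sqd P a b = s a b" if "a \<in> loc" "b \<in> loc" "a \<noteq> b" for a b
  proof -
    have "dist (P a) (P b) = ell a b" using P that by (simp add: realizes_def)
    then show ?thesis unfolding sqd_def s_def power2_norm_eq_inner[symmetric] dist_norm[symmetric] by simp
  qed
  note d = local_quad(2,3)[OF ij]
  have "dist (P i) (P j) = ell i j" using P ij by (simp add: realizes_def)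
  then have "P i \<noteq> P j" using nz by auto
  then have "dihedral_len ell i j = arccos (nrm2 (sqd P) i j (other1 i j) (other2 i j) /
     (sqrt (par2 (sqd P) i j (other1 i j)) * sqrt (par2 (sqd P) i j (other2 i j))))"
    unfolding dihedral_len_def Let_def P_def[symmetric] by (rule dihedral_pts_eq)
  also have "nrm2 (sqd P) i j (other1 i j) (other2 i j) = nrm2 s i j (other1 i j) (other2 i j)"
    by (rule nrm2_cong) (use d sq in auto)
  also have "par2 (sqd P) i j (other1 i j) = par2 s i j (other1 i j)"
    by (rule par2_cong) (use d sq in auto)
  also have "par2 (sqd P) i j (other2 i j) = par2 s i j (other2 i j)"
    by (rule par2_cong) (use d sq in auto)
  finally show ?thesis .
qed

text \<open>The arrangements are those of \<open>local_quads\<close>; each sign is the parity of the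
  arrangement.\<close>

lemma triple_ovol:
  "triple A B C D = 6 * ovol A B C D" "triple A C B D = - (6 * ovol A B C D)"
  "triple A D B C = 6 * ovol A B C D" "triple B C A D = 6 * ovol A B C D"
  "triple B D A C = - (6 * ovol A B C D)" "triple C D A B = 6 * ovol A B C D"
proof -
  show *: "triple A B C D = 6 * ovol A B C D"
    by (simp add: triple_def ovol_def det_3 cross3_def inner_vec_def sum_3 algebra_simps)
  show "triple A C B D = - (6 * ovol A B C D)"
    "triple A D B C = 6 * ovol A B C D" "triple B C A D = 6 * ovol A B C D"
    "triple B D A C = - (6 * ovol A B C D)" "triple C D A B = 6 * ovol A B C D"
    unfolding *[symmetric] by (simp_all add: triple_def cross3_def inner_vec_def sum_3 algebra_simps)
qed

lemma has_derivative_vec_componentwise: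
  fixes f :: "'a::real_normed_vector \<Rightarrow> real^'n"
  assumes "\<And>i. ((\<lambda>x. f x $ i) has_derivative (\<lambda>v. f' v $ i)) (at x)"
  shows "(f has_derivative f') (at x)"
  using assms
  by (subst has_derivative_componentwise_within) (auto simp: Basis_vec_def inner_axis)

lemma dist_nth_has_derivative:
  fixes X :: "(real^3)^'v::finite"
  assumes "X $ a \<noteq> X $ b"
  shows "((\<lambda>Y. dist (Y $ a) (Y $ b)) has_derivative
     (\<lambda>y. ((X $ a - X $ b) \<bullet> (y $ a - y $ b)) / dist (X $ a) (X $ b))) (at X)"
proof -
  have 1: "((\<lambda>Y. Y $ a - Y $ b) has_derivative (\<lambda>y. y $ a - y $ b)) (at X)"
    by (intro has_derivative_diff bounded_linear_imp_has_derivative bounded_linear_vec_nth)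
  have "((\<lambda>Y. norm (Y $ a - Y $ b)) has_derivative (\<lambda>y. (y $ a - y $ b) \<bullet> sgn (X $ a - X $ b))) (at X)"
    using assms by (intro has_derivative_compose[OF 1, of norm] has_derivative_norm) simp
  then show ?thesis
    unfolding dist_norm
    by (rule has_derivative_eq_rhs) (simp add: sgn_div_norm inner_commute divide_inverse fun_eq_iff mult.commute)
qed

section \<open>The maps of the complex at a generic configuration\<close>

text \<open>Genericity enters as nonvanishing of the oriented volumes: lengths are then positive and
  dihedral angles lie strictly between 0 and pi, where \<open>arccos\<close> is smooth.\<close>

locale generic_triangulation = triangulation glue gperm vtx edg
  for glue :: "'t::finite \<Rightarrow> nat \<Rightarrow> 't" and gperm
    and vtx :: "'t \<Rightarrow> nat \<Rightarrow> 'v::finite" and edg :: "'t \<Rightarrow> nat \<Rightarrow> nat \<Rightarrow> 'e::finite" +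
  fixes X :: "real^3^'v"
  assumes generic: "\<And>t. tvol vtx X t \<noteq> 0"
begin

abbreviation "len0 \<equiv> edge_lengths vtx edg X"

definition pts :: "(real^3^'v) \<Rightarrow> 't \<Rightarrow> nat \<Rightarrow> real^3" where
  "pts Y t a = Y $ vtx t a"

definition sq_len :: "real^'e \<Rightarrow> 't \<Rightarrow> nat \<Rightarrow> nat \<Rightarrow> real" where
  "sq_len l t a b = (l $ edg t a b)\<^sup>2"

definition dsq_len :: "real^'e \<Rightarrow> 't \<Rightarrow> nat \<Rightarrow> nat \<Rightarrow> real" where
  "dsq_len b t a c = 2 * len0 $ edg t a c * b $ edg t a c"

lemma triple_pts:
  assumes "(h, k, f, g) \<in> local_quads"
  shows "triple (pts X t h) (pts X t k) (pts X t f) (pts X t g) \<noteq> 0"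
proof -
  have "ovol (pts X t 0) (pts X t 1) (pts X t 2) (pts X t 3) \<noteq> 0"
    using generic[of t] by (simp add: tvol_def pts_def)
  then show ?thesis using assms by (elim insertE; simp add: triple_ovol[where A = "pts X t 0" and B = "pts X t 1" and C = "pts X t 2" and D = "pts X t 3"] del: One_nat_def)
qed

lemma pts_distinct:
  assumes "a \<in> loc" "b \<in> loc" "a \<noteq> b"
  shows "pts X t a \<noteq> pts X t b"
proof -
  have *: "pts X t a \<noteq> pts X t b" if "a \<in> loc" "b \<in> loc" "a < b" for a b
  proof
    assume "pts X t a = pts X t b"
    then have "triple (pts X t a) (pts X t b) (pts X t (other1 a b)) (pts X t (other2 a b)) = 0"
      by (simp add: triple_def)
    with triple_pts[OF local_quad(1)[OF that]] show False by blast
  qed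
  then show ?thesis using assms by (metis linorder_neqE_nat)
qed

lemma len0_nth:
  assumes "a \<in> loc" "b \<in> loc" "a \<noteq> b"
  shows "len0 $ edg t a b = dist (pts X t a) (pts X t b)" "len0 $ edg t a b > 0"
  using edge_lengths_nth[OF assms] pts_distinct[OF assms] by (simp_all add: pts_def)

lemma sq_len0:
  assumes "a \<in> loc" "b \<in> loc" "a \<noteq> b"
  shows "sq_len len0 t a b = sqd (pts X t) a b"
  unfolding sq_len_def len0_nth(1)[OF assms] sqd_def dist_norm power2_norm_eq_inner ..

lemma local_quad_positive:
  assumes q: "(h, k, f, g) \<in> local_quads"
  shows "len0 $ edg t h k > 0" "par2 (sq_len len0 t) h k f > 0" "par2 (sq_len len0 t) h k g > 0"
    "par2 (sq_len len0 t) h k f * par2 (sq_len len0 t) h k g - (nrm2 (sq_len len0 t) h k f g)\<^sup>2 > 0"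
proof -
  have l: "h \<in> loc" "k \<in> loc" "f \<in> loc" "g \<in> loc" "h \<noteq> k" "h \<noteq> f" "h \<noteq> g" "k \<noteq> f" "k \<noteq> g" "f \<noteq> g"
    using q by (auto simp: loc_eq)
  show "len0 $ edg t h k > 0" by (rule len0_nth(2)[OF l(1,2,5)])
  let ?P = "pts X t"
  have e: "par2 (sq_len len0 t) h k f = par2 (sqd ?P) h k f" "par2 (sq_len len0 t) h k g = par2 (sqd ?P) h k g"
    "nrm2 (sq_len len0 t) h k f g = nrm2 (sqd ?P) h k f g"
    by (rule par2_cong nrm2_cong; rule sq_len0; rule l)+
  have pp: "par2 (sqd ?P) h k f * par2 (sqd ?P) h k g - (nrm2 (sqd ?P) h k f g)\<^sup>2 > 0"
    unfolding par2_nrm2_triple using triple_pts[OF q, of t] pts_distinct[OF l(1,2,5), of t] by simp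
  moreover have "par2 (sqd ?P) h k f \<ge> 0" "par2 (sqd ?P) h k g \<ge> 0" by (simp_all add: par2_sqd)
  moreover have "par2 (sqd ?P) h k f * par2 (sqd ?P) h k g > 0"
    using pp zero_le_power2[of "nrm2 (sqd ?P) h k f g"] by linarith
  ultimately show "par2 (sq_len len0 t) h k f > 0" "par2 (sq_len len0 t) h k g > 0"
    "par2 (sq_len len0 t) h k f * par2 (sq_len len0 t) h k g - (nrm2 (sq_len len0 t) h k f g)\<^sup>2 > 0"
    unfolding e by (auto simp: zero_less_mult_iff)
qed

lemma sq_len_has_derivative:
  "((\<lambda>l. sq_len l t a b) has_derivative (\<lambda>v. dsq_len v t a b)) (at len0)"
proof -
  have 1: "((\<lambda>l. l $ edg t a b) has_derivative (\<lambda>v. v $ edg t a b)) (at len0)"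
    by (intro bounded_linear_imp_has_derivative bounded_linear_vec_nth)
  show ?thesis unfolding sq_len_def dsq_len_def
    by (rule has_derivative_eq_rhs[OF has_derivative_power[OF 1]]) (auto simp: mult_ac)
qed

text \<open>For unrealizable lengths \<open>dihedral_len\<close> has an arbitrary value. The strict
  inequalities required by \<open>realizable\<close> hold at \<open>len0\<close> and are open
  conditions by continuity.\<close>

lemma eventually_realizable:
  "\<forall>\<^sub>F l in nhds len0. (\<exists>P. realizes (\<lambda>a b. l $ edg t a b) P) \<and> (\<forall>a\<in>loc. \<forall>b\<in>loc. a \<noteq> b \<longrightarrow> l $ edg t a b > 0)"
proof -
  have fin: "finite loc" by (simp add: loc_def)
  note q = local_quad_positive[of 0 1 2 3 t, simplified]
  have pos: "\<forall>\<^sub>F l in nhds len0. 0 < F l"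
    if "(F has_derivative F') (at len0)" "0 < F len0" for F :: "real^'e \<Rightarrow> real" and F'
  proof -
    have "(F \<longlongrightarrow> F len0) (nhds len0)"
      using has_derivative_continuous[OF that(1)] by (simp add: continuous_within tendsto_at_iff_tendsto_nhds)
    then show ?thesis using that(2) by (rule order_tendstoD(1))
  qed
  have 1: "\<forall>\<^sub>F l in nhds len0. \<forall>a\<in>loc. \<forall>b\<in>loc. a \<noteq> b \<longrightarrow> l $ edg t a b > 0"
  proof (intro eventually_ball_finite[OF fin] ballI)
    fix a b assume ab: "a \<in> loc" "b \<in> loc"
    show "\<forall>\<^sub>F l in nhds len0. a \<noteq> b \<longrightarrow> l $ edg t a b > 0"
    proof (cases "a = b")
      case False
      then have "\<forall>\<^sub>F l in nhds len0. l $ edg t a b > 0"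
        by (intro pos[OF bounded_linear_imp_has_derivative[OF bounded_linear_vec_nth]] len0_nth ab)
      then show ?thesis by eventually_elim simp
    qed simp
  qed
  have 2: "\<forall>\<^sub>F l in nhds len0. par2 (sq_len l t) 0 1 2 > 0"
    by (rule pos[OF par2_has_derivative[OF sq_len_has_derivative]]) (use q in simp)
  have 3: "\<forall>\<^sub>F l in nhds len0. par2 (sq_len l t) 0 1 2 * par2 (sq_len l t) 0 1 3 - (nrm2 (sq_len l t) 0 1 2 3)\<^sup>2 > 0"
    by (rule pos[OF has_derivative_diff[OF has_derivative_mult[OF
          par2_has_derivative[OF sq_len_has_derivative] par2_has_derivative[OF sq_len_has_derivative]]
        has_derivative_power[OF nrm2_has_derivative[OF sq_len_has_derivative]]]]) (use q in simp)
  from 1 2 3 show ?thesis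
  proof eventually_elim
    case (elim l)
    have "\<exists>P. realizes (\<lambda>a b. l $ edg t a b) P"
      by (rule realizable) (use elim in \<open>simp_all add: sq_len_def[abs_def] edg_commute[of t]\<close>)
    then show ?case using elim by blast
  qed
qed

lemma dihedral_len_has_derivative:
  assumes ij: "i \<in> loc" "j \<in> loc" "i < j"
  shows "((\<lambda>l. dihedral_len (\<lambda>a b. l $ edg t a b) i j) has_derivative
    (\<lambda>v. dangle (sq_len len0 t) (dsq_len v t) i j (other1 i j) (other2 i j))) (at len0)"
proof -
  let ?F = "\<lambda>l. arccos (nrm2 (sq_len l t) i j (other1 i j) (other2 i j) /
     (sqrt (par2 (sq_len l t) i j (other1 i j)) * sqrt (par2 (sq_len l t) i j (other2 i j))))"
  \<comment> \<open>The explicit formula agrees with \<open>dihedral_len\<close> on a neighbourhood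
    including the point itself, so its derivative carries over.\<close>
  have ev: "\<forall>\<^sub>F l in nhds len0. ?F l = dihedral_len (\<lambda>a b. l $ edg t a b) i j"
    using eventually_realizable[of t]
  proof eventually_elim
    case (elim l)
    with ij have "l $ edg t i j \<noteq> 0" by fastforce
    with elim ij show ?case unfolding sq_len_def[abs_def] by (intro dihedral_len_eq[symmetric]) auto
  qed
  have "(?F has_derivative (\<lambda>v. dangle (sq_len len0 t) (dsq_len v t) i j (other1 i j) (other2 i j))) (at len0)"
    by (rule dangle_has_derivative[OF sq_len_has_derivative])
      (rule local_quad_positive[OF local_quad(1)[OF ij]])+
  then show ?thesis
    by (rule has_derivative_transform_eventually)
      (use ev eventually_nhds_x_imp_x[OF ev] in \<open>auto simp: eventually_at_filter elim: eventually_mono\<close>)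
qed

definition dangle_sum :: "real^'e \<Rightarrow> 't \<Rightarrow> 'e \<Rightarrow> real" where
  "dangle_sum b t e = (\<Sum>(i, j)\<in>{(i, j). i \<in> loc \<and> j \<in> loc \<and> i < j \<and> edg t i j = e}.
     dangle (sq_len len0 t) (dsq_len b t) i j (other1 i j) (other2 i j))"

lemma neg_angle_sum_has_derivative:
  "(neg_angle_sum vtx edg X has_derivative
     (\<lambda>b. \<chi> e. - (\<Sum>t\<in>UNIV. sgn (tvol vtx X t) * dangle_sum b t e))) (at len0)"
proof (rule has_derivative_vec_componentwise)
  fix e
  show "((\<lambda>l. neg_angle_sum vtx edg X l $ e) has_derivative
      (\<lambda>v. (\<chi> e. - (\<Sum>t\<in>UNIV. sgn (tvol vtx X t) * dangle_sum v t e)) $ e)) (at len0)"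
    unfolding neg_angle_sum_def dangle_sum_def vec_lambda_beta sum_distrib_left case_prod_unfold
    by (intro has_derivative_minus has_derivative_sum has_derivative_mult_right dihedral_len_has_derivative) auto
qed

lemma f3_nth: "f3 vtx edg X b $ e = - (\<Sum>t\<in>UNIV. sgn (tvol vtx X t) * dangle_sum b t e)"
  unfolding f3_def frechet_derivative_at[OF neg_angle_sum_has_derivative, symmetric] by simp

lemma edge_component:
  obtains t i j where "i \<in> loc" "j \<in> loc" "i \<noteq> j" "edg t i j = e"
  using edg_surj by blast

lemma edge_lengths_differentiable: "edge_lengths vtx edg differentiable (at X)"
proof -
  have "\<exists>D. ((\<lambda>Y. edge_lengths vtx edg Y $ e) has_derivative D) (at X)" for e
  proof -
    obtain t i j where ij: "i \<in> loc" "j \<in> loc" "i \<noteq> j" "edg t i j = e" by (rule edge_component)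
    show ?thesis unfolding ij(4)[symmetric] edge_lengths_nth[OF ij(1-3)]
      using dist_nth_has_derivative[of X "vtx t i" "vtx t j"] pts_distinct[OF ij(1-3), of t] by (auto simp: pts_def)
  qed
  then obtain D where D: "\<And>e. ((\<lambda>Y. edge_lengths vtx edg Y $ e) has_derivative D e) (at X)" by metis
  have "(edge_lengths vtx edg has_derivative (\<lambda>y. \<chi> e. D e y)) (at X)"
    by (rule has_derivative_vec_componentwise) (simp add: D)
  then show ?thesis by (rule differentiableI)
qed

lemma f2_has_derivative: "(edge_lengths vtx edg has_derivative f2 vtx edg X) (at X)"
  unfolding f2_def by (rule iffD1[OF frechet_derivative_works edge_lengths_differentiable])

lemma f2_nth:
  assumes "i \<in> loc" "j \<in> loc" "i \<noteq> j"
  shows "f2 vtx edg X y $ edg t i j =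
    ((pts X t i - pts X t j) \<bullet> (pts y t i - pts y t j)) / dist (pts X t i) (pts X t j)"
proof -
  have 1: "((\<lambda>Y. edge_lengths vtx edg Y $ edg t i j) has_derivative (\<lambda>y. f2 vtx edg X y $ edg t i j)) (at X)"
    by (rule bounded_linear.has_derivative[OF bounded_linear_vec_nth f2_has_derivative])
  have 2: "((\<lambda>Y. edge_lengths vtx edg Y $ edg t i j) has_derivative
      (\<lambda>y. ((pts X t i - pts X t j) \<bullet> (pts y t i - pts y t j)) / dist (pts X t i) (pts X t j))) (at X)"
    unfolding edge_lengths_nth[OF assms] pts_def
    by (rule dist_nth_has_derivative) (use pts_distinct[OF assms, of t] in \<open>simp add: pts_def\<close>)
  show ?thesis using fun_cong[OF has_derivative_unique[OF 1 2]] .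
qed

section \<open>Vanishing of the compositions\<close>

lemma f2_f1: "f2 vtx edg X (f1 X z) = 0"
proof -
  obtain a b where z: "z = (a, b)" by (cases z)
  have "f2 vtx edg X (f1 X z) $ e = 0" for e
  proof -
    obtain t i j where ij: "i \<in> loc" "j \<in> loc" "i \<noteq> j" "edg t i j = e" by (rule edge_component)
    \<comment> \<open>The translation cancels, and a rotation moves the edge vector orthogonally to
      itself.\<close>
    have "pts (f1 X z) t i - pts (f1 X z) t j = cross3 b (pts X t i - pts X t j)"
      by (simp add: pts_def f1_def z right_diff_distrib cross3_simps)
    then show ?thesis unfolding ij(4)[symmetric] f2_nth[OF ij(1-3)] by (simp add: dot_cross_self)
  qed
  then show ?thesis by (simp add: vec_eq_iff)
qed

text \<open>This brings the contribution of one tetrahedron into the form summed in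
  \<open>flag_sum_zero\<close>.\<close>

lemma dangle_sum_f2:
  fixes y :: "real^3^'v"
  defines "H \<equiv> \<lambda>u v w. azimuth_rate (X $ u) (X $ v) (X $ w) (y $ u) (y $ v) (y $ w)"
  shows "sgn (tvol vtx X t) * dangle_sum (f2 vtx edg X y) t e =
    (\<Sum>\<sigma>\<in>{\<sigma>. \<sigma> permutes loc}. of_int (sign \<sigma>) *
     (if edg t (\<sigma> 0) (\<sigma> 1) = e then H (vtx t (\<sigma> 0)) (vtx t (\<sigma> 1)) (vtx t (\<sigma> 3)) else 0)) / 2"
proof -
  let ?s = "sgn (tvol vtx X t)"
  define K where "K i j m = (if edg t i j = e then H (vtx t i) (vtx t j) (vtx t m) else 0)" for i j m
  have K: "K j i m = - K i j m" for i j m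
    unfolding K_def H_def edg_commute[of t j i] azimuth_rate_swap[of "X $ vtx t j"] by simp
  have s2: "?s * ?s = 1" using generic[of t] by (simp add: sgn_if)
  define T where "T h k f g = triple (pts X t h) (pts X t k) (pts X t f) (pts X t g)" for h k f g
  have D: "?s * (if edg t h k = e then dangle (sq_len len0 t) (dsq_len (f2 vtx edg X y) t) h k f g else 0)
      = ?s * sgn (T h k f g) * (K h k g - K h k f)"
    if q: "(h, k, f, g) \<in> local_quads" for h k f g
  proof -
    have l: "h \<in> loc" "k \<in> loc" "f \<in> loc" "g \<in> loc" "h \<noteq> k" "h \<noteq> f" "h \<noteq> g" "k \<noteq> f" "k \<noteq> g" "f \<noteq> g"
      using q by (auto simp: loc_eq)
    \<comment> \<open>Chain rule: the factor 2l from squaring the length cancels the 1/l in the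
      derivative of the distance.\<close>
    have d: "dsq_len (f2 vtx edg X y) t a b = dsqd (pts X t) (pts y t) a b"
      if "a \<in> loc" "b \<in> loc" "a \<noteq> b" for a b
      using len0_nth(2)[OF that, of t]
      unfolding dsq_len_def f2_nth[OF that] dsqd_def len0_nth(1)[OF that] by simp
    have "dangle (sq_len len0 t) (dsq_len (f2 vtx edg X y) t) h k f g
       = dangle (sqd (pts X t)) (dsqd (pts X t) (pts y t)) h k f g"
      by (rule dangle_cong; (rule sq_len0 d)) (rule l)+
    also have "\<dots> = sgn (T h k f g) * (H (vtx t h) (vtx t k) (vtx t g) - H (vtx t h) (vtx t k) (vtx t f))"
      unfolding dangle_sqd[of "pts X t", OF triple_pts[OF q]] H_def T_def by (simp add: pts_def)
    finally show ?thesis by (simp add: K_def)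
  qed
  \<comment> \<open>The sign of the volume appears here a second time and cancels by
    \<open>s2\<close>; only the parity of each arrangement survives.\<close>
  have T: "sgn (T 0 1 2 3) = ?s" "sgn (T 0 2 1 3) = - ?s" "sgn (T 0 3 1 2) = ?s" "sgn (T 1 2 0 3) = ?s"
    "sgn (T 1 3 0 2) = - ?s" "sgn (T 2 3 0 1) = ?s"
    unfolding T_def triple_ovol[where A = "pts X t 0" and B = "pts X t 1" and C = "pts X t 2" and D = "pts X t 3"]
    unfolding tvol_def pts_def
    by (simp_all add: sgn_mult sgn_minus del: One_nat_def)
  \<comment> \<open>The six facts state membership of the successive elements of
    \<open>local_quads\<close>.\<close>
  note q = insertI1 insertI2[OF insertI1] insertI2[OF insertI2[OF insertI1]]
    insertI2[OF insertI2[OF insertI2[OF insertI1]]]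
    insertI2[OF insertI2[OF insertI2[OF insertI2[OF insertI1]]]]
    insertI2[OF insertI2[OF insertI2[OF insertI2[OF insertI2[OF insertI1]]]]]
  have "?s * dangle_sum (f2 vtx edg X y) t e = (K 0 1 3 - K 0 1 2) - (K 0 2 3 - K 0 2 1) + (K 0 3 2 - K 0 3 1)
       + (K 1 2 3 - K 1 2 0) - (K 1 3 2 - K 1 3 0) + (K 2 3 1 - K 2 3 0)"
    unfolding dangle_sum_def sum_local_edges distrib_left others
      D[OF q(1)] D[OF q(2)] D[OF q(3)] D[OF q(4)] D[OF q(5)] D[OF q(6)] T mult_minus_right s2
    by simp
  also have "\<dots> = (\<Sum>\<sigma>\<in>{\<sigma>. \<sigma> permutes loc}. of_int (sign \<sigma>) * K (\<sigma> 0) (\<sigma> 1) (\<sigma> 3)) / 2"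
    using sum_permutations_loc[of K, OF K] by simp
  finally show ?thesis unfolding K_def .
qed

lemma f3_f2: "f3 vtx edg X (f2 vtx edg X y) = 0"
proof -
  have "f3 vtx edg X (f2 vtx edg X y) $ e = 0" for e
    unfolding f3_nth dangle_sum_f2 sum_divide_distrib[symmetric]
      flag_sum_zero[where H = "\<lambda>u v w. azimuth_rate (X $ u) (X $ v) (X $ w) (y $ u) (y $ v) (y $ w)"]
    by simp
  then show ?thesis by (simp add: vec_eq_iff)
qed

lemma f3_symmetric: "f3 vtx edg X a \<bullet> b = f3 vtx edg X b \<bullet> a"
proof -
  define D where "D a t = dangle (sq_len len0 t) (dsq_len a t)" for a t
  define Q where "Q a b t = D a t 0 1 2 3 * b $ edg t 0 1 + D a t 0 2 1 3 * b $ edg t 0 2 + D a t 0 3 1 2 * b $ edg t 0 3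
      + D a t 1 2 0 3 * b $ edg t 1 2 + D a t 1 3 0 2 * b $ edg t 1 3 + D a t 2 3 0 1 * b $ edg t 2 3" for a b t
  have 1: "f3 vtx edg X a \<bullet> b = - (\<Sum>t\<in>UNIV. sgn (tvol vtx X t) * Q a b t)" for a b
  proof -
    \<comment> \<open>Pairing with \<open>b\<close> collapses the sum over global edges, leaving one
      bilinear form in the six local edges per tetrahedron; symmetry can then be checked in each
      tetrahedron.\<close>
    have one: "(\<Sum>e\<in>UNIV. (if edg t i j = e then x else 0) * b $ e) = x * b $ edg t i j" for t i j x
      by (simp add: if_distrib[of "\<lambda>z. z * _"] cong: if_cong)
    have "(\<Sum>e\<in>UNIV. dangle_sum a t e * b $ e) = Q a b t" for t
      unfolding dangle_sum_def sum_local_edges distrib_right sum.distrib one others Q_def D_def ..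
    then have "sgn (tvol vtx X t) * Q a b t = (\<Sum>e\<in>UNIV. sgn (tvol vtx X t) * dangle_sum a t e * b $ e)" for t
      unfolding mult.assoc sum_distrib_left[symmetric] by simp
    then have "(\<Sum>t\<in>UNIV. sgn (tvol vtx X t) * Q a b t)
       = (\<Sum>t\<in>UNIV. \<Sum>e\<in>UNIV. sgn (tvol vtx X t) * dangle_sum a t e * b $ e)"
      by simp
    also have "\<dots> = (\<Sum>e\<in>UNIV. \<Sum>t\<in>UNIV. sgn (tvol vtx X t) * dangle_sum a t e * b $ e)"
      by (rule sum.swap)
    finally show ?thesis unfolding inner_vec_def f3_nth
      by (simp add: sum_distrib_right sum_negf)
  qed
  have "Q a b t = Q b a t" for t
    unfolding Q_def D_def sq_len_def[abs_def] dsq_len_def[abs_def]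
  proof (rule dangle_form_symmetric[of "\<lambda>x y. len0 $ edg t x y" "\<lambda>x y. a $ edg t x y" "\<lambda>x y. b $ edg t x y"])
    show "len0 $ edg t x y = len0 $ edg t y x" "a $ edg t x y = a $ edg t y x" "b $ edg t x y = b $ edg t y x" for x y
      by (simp_all add: edg_commute[of t x y])
    show "len0 $ edg t h k > 0 \<and> par2 (\<lambda>x y. (len0 $ edg t x y)\<^sup>2) h k f > 0 \<and> par2 (\<lambda>x y. (len0 $ edg t x y)\<^sup>2) h k g > 0"
      if "(h, k, f, g) \<in> local_quads" for h k f g
      using local_quad_positive[OF that] unfolding sq_len_def[abs_def] by blast
  qed
  then show ?thesis unfolding 1 by simp
qed

text \<open>Tested against any \<open>y\<close>, the composition gives minus the inner product of f3
  (f2 y) with \<open>a\<close>. Linearity of f2 ensures that \<open>adjoint\<close> has its defining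
  property.\<close>

lemma f4_f3: "f4 vtx edg X (f3 vtx edg X a) = 0"
proof -
  have lin: "linear (f2 vtx edg X)" by (rule has_derivative_linear[OF f2_has_derivative])
  have "y \<bullet> f4 vtx edg X (f3 vtx edg X a) = 0" for y
  proof -
    have "y \<bullet> f4 vtx edg X (f3 vtx edg X a) = - (f2 vtx edg X y \<bullet> f3 vtx edg X a)"
      by (simp add: f4_def adjoint_works[OF lin])
    also have "\<dots> = - (f3 vtx edg X (f2 vtx edg X y) \<bullet> a)"
      unfolding inner_commute[of "f2 vtx edg X y"] f3_symmetric[of a] ..
    finally show ?thesis by (simp add: f3_f2)
  qed
  then show ?thesis by (metis inner_eq_zero_iff)
qed

lemma f5_f4: "f5 X (f4 vtx edg X w) = 0"
proof -
  have lin: "linear (f2 vtx edg X)" by (rule has_derivative_linear[OF f2_has_derivative])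
  have lin1: "linear (f1 X)"
    by (rule linearI) (auto simp: f1_def vec_eq_iff cross_add_left cross_mult_left algebra_simps)
  have "z \<bullet> f5 X (f4 vtx edg X w) = 0" for z
    by (simp add: f5_def f4_def adjoint_works[OF lin1] adjoint_works[OF lin] f2_f1)
  then show ?thesis by (metis inner_eq_zero_iff)
qed

end

text \<open>Differentiability is asserted along with the complex because
  \<open>frechet_derivative\<close> yields the true Jacobian only then. The condition on
  \<open>f1 X 0\<close> covers the arrow from the zero space.\<close>

theorem theorem1:
  fixes glue :: "'t::finite \<Rightarrow> nat \<Rightarrow> 't"
    and gperm :: "'t \<Rightarrow> nat \<Rightarrow> nat \<Rightarrow> nat"
    and vtx :: "'t \<Rightarrow> nat \<Rightarrow> 'v::finite"
    and edg :: "'t \<Rightarrow> nat \<Rightarrow> nat \<Rightarrow> 'e::finite"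
    and X :: "real^3^'v"
  assumes M: "closed_oriented_triangulated_3manifold glue gperm vtx edg"
    and generic: "\<forall>t. tvol vtx X t \<noteq> 0"
  shows "edge_lengths vtx edg differentiable (at X)
    \<and> neg_angle_sum vtx edg X differentiable (at (edge_lengths vtx edg X))
    \<and> f1 X 0 = 0
    \<and> f2 vtx edg X \<circ> f1 X = (\<lambda>_. 0)
    \<and> f3 vtx edg X \<circ> f2 vtx edg X = (\<lambda>_. 0)
    \<and> f4 vtx edg X \<circ> f3 vtx edg X = (\<lambda>_. 0)
    \<and> f5 X \<circ> f4 vtx edg X = (\<lambda>_. 0)"
proof -
  interpret generic_triangulation glue gperm vtx edg X
    using M generic by unfold_locales auto
  have "f1 X 0 = 0" by (simp add: f1_def vec_eq_iff zero_prod_def)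
  then show ?thesis
    using edge_lengths_differentiable neg_angle_sum_has_derivative
    by (auto simp: fun_eq_iff f2_f1 f3_f2 f4_f3 f5_f4 intro: differentiableI)
qed

end
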